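(* Let $a>0$ and let $\{\lambda_n\}$ be a sequence of complex numbers. Put $e_{\lambda}(t)=\exp(i\lambda t)$ for $t\in(-a,a)$. If the sequence of normalized exponentials $\{e_{\lambda_n}/\|e_{\lambda_n}\|\}$ is a Bessel sequence in $L^2(-a,a)$, where $\|\cdot\|$ is the norm of $L^2(-a,a)$, then it splits into finitely many Riesz basic sequences.
   Context: A sequence of unit vectors $\{h_n\}$ in a separable Hilbert space $\mathcal H$ is a Bessel sequence if there is a constant $C>0$ with $\sum_n|\langle h,h_n\rangle_{\mathcal H}|^2\le C\|h\|_{\mathcal H}^2$ for every $h\in\mathcal H$. A sequence $\{h_n\}\subset\mathcal H$ is a Riesz basic sequence if there is a constant $A>0$ such that $A^{-1}\sum_n|c_n|^2\le\|\sum_n c_nh_n\|_{\mathcal H}^2\le A\sum_n|c_n|^2$ for every finite sequence $\{c_n\}\subset\mathbb{C}$. "Splits into finitely many Riesz basic sequences" means that the index set can be partitioned into finitely many subsets such that the subfamily corresponding to each subset is a Riesz basic sequence. *)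

theory Defs
  imports "HOL-Analysis.Analysis" "HOL-Library.Disjoint_Sets"
begin

text \<open>
  Elements of the complex Hilbert space \<open>L\<^sup>2(M)\<close> are given by representatives: square-integrable
  functions that are not identified when they agree almost everywhere. The notions below depend
  only on inner products and norms, hence only on the classes.
\<close>

definition L2_space :: "'a measure \<Rightarrow> ('a \<Rightarrow> complex) set" where
  "L2_space M = {f \<in> borel_measurable M. integrable M (\<lambda>t. (cmod (f t))\<^sup>2)}"

definition L2_inner :: "'a measure \<Rightarrow> ('a \<Rightarrow> complex) \<Rightarrow> ('a \<Rightarrow> complex) \<Rightarrow> complex" where
  "L2_inner M f g = (LINT t|M. f t * cnj (g t))"

definition L2_norm :: "'a measure \<Rightarrow> ('a \<Rightarrow> complex) \<Rightarrow> real" where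
  "L2_norm M f = sqrt (LINT t|M. (cmod (f t))\<^sup>2)"

text \<open>
  Summability is demanded explicitly because \<open>suminf\<close> of a divergent series is unspecified.
\<close>

definition Bessel_sequence :: "'a measure \<Rightarrow> (nat \<Rightarrow> 'a \<Rightarrow> complex) \<Rightarrow> bool" where
  "Bessel_sequence M h \<longleftrightarrow>
     (\<forall>n. h n \<in> L2_space M) \<and>
     (\<exists>C>0. \<forall>f\<in>L2_space M.
        summable (\<lambda>n. (cmod (L2_inner M f (h n)))\<^sup>2) \<and>
        (\<Sum>n. (cmod (L2_inner M f (h n)))\<^sup>2) \<le> C * (L2_norm M f)\<^sup>2)"

text \<open>
  The subfamily of \<open>h\<close> with index set \<open>I\<close>; \<open>I\<close> may be finite, and a finite coefficient sequence is
  a function \<open>c\<close> together with a finite set \<open>F \<subseteq> I\<close> of indices.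
\<close>

definition Riesz_basic_on :: "'a measure \<Rightarrow> 'i set \<Rightarrow> ('i \<Rightarrow> 'a \<Rightarrow> complex) \<Rightarrow> bool" where
  "Riesz_basic_on M I h \<longleftrightarrow>
     (\<forall>n\<in>I. h n \<in> L2_space M) \<and>
     (\<exists>A>0. \<forall>F c. finite F \<and> F \<subseteq> I \<longrightarrow>
        inverse A * (\<Sum>n\<in>F. (cmod (c n))\<^sup>2) \<le> (L2_norm M (\<lambda>t. \<Sum>n\<in>F. c n * h n t))\<^sup>2 \<and>
        (L2_norm M (\<lambda>t. \<Sum>n\<in>F. c n * h n t))\<^sup>2 \<le> A * (\<Sum>n\<in>F. (cmod (c n))\<^sup>2))"

definition splits_into_finitely_many_Riesz_basic ::
    "'a measure \<Rightarrow> ('i \<Rightarrow> 'a \<Rightarrow> complex) \<Rightarrow> bool" where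
  "splits_into_finitely_many_Riesz_basic M h \<longleftrightarrow>
     (\<exists>P. partition_on UNIV P \<and> finite P \<and> (\<forall>I\<in>P. Riesz_basic_on M I h))"

definition exponential :: "complex \<Rightarrow> real \<Rightarrow> complex" where
  "exponential \<mu> t = exp (\<i> * \<mu> * of_real t)"

definition L2_normalize :: "'a measure \<Rightarrow> ('a \<Rightarrow> complex) \<Rightarrow> 'a \<Rightarrow> complex" where
  "L2_normalize M f t = f t / of_real (L2_norm M f)"

end

theory Submission
  imports Defs "HOL-Computational_Algebra.Polynomial" "HOL-Real_Asymp.Real_Asymp"
begin

text \<open>
  By the reflection \<open>t \<mapsto> - t\<close> it suffices to treat the frequencies in the closed upper half-plane.
  Multiplication by \<open>exp (- H t)\<close> moves them to \<open>\<mu> n = lam n + \<i> H\<close>. There the Gram matrix of the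
  normalized exponentials on \<open>(0, \<infinity>)\<close> is the Cauchy matrix \<open>K j k = 2 \<i> sqrt (Im (\<mu> j) Im (\<mu> k)) / (\<mu> j - cnj (\<mu> k))\<close>,
  and the Gram matrix on an interval of length \<open>2 a\<close> differs from it by at most \<open>exp (- 4 a H)\<close> times
  its norm, while the Bessel constant \<open>B\<close> of the shifted system is only \<open>O(H)\<close>.

  The Bessel bound gives \<open>(\<Sum>k. (cmod (K j k))\<^sup>2) \<le> B\<close>, so the indices can be coloured with finitely many
  colours such that each monochromatic off-diagonal row sum is at most \<open>1/2\<close>. Since
  \<open>1 - (cmod (K j k))\<^sup>2\<close> is the squared pseudohyperbolic distance, the Blaschke products \<open>\<beta> j\<close> over
  one colour then satisfy \<open>(cmod (\<beta> j))\<^sup>2 \<ge> 1/2\<close>. The Cauchy matrix has the explicit inverse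
  \<open>diag (1 / cnj \<beta>) K\<^sup>T diag (1 / \<beta>)\<close>, of norm at most \<open>2 B\<close>; hence \<open>K \<ge> 1 / (2 B)\<close>, and this beats the
  error \<open>B exp (- 4 a H)\<close> once \<open>H\<close> is large.
\<close>

section \<open>Cauchy matrices and Blaschke products\<close>

text \<open>Both sides are polynomials in \<open>z\<close> of degree below \<open>card F\<close> and
  they agree at the \<open>card F\<close> distinct nodes.\<close>

lemma lagrange_interpolation:
  fixes p :: "'a::field poly"
  assumes F: "finite F" and inj: "inj_on x F" and deg: "degree p < card F"
  shows "poly p z = (\<Sum>k\<in>F. poly p (x k) * (\<Prod>m\<in>F-{k}. (z - x m) / (x k - x m)))"
proof -
  define L where "L k = (\<Prod>m\<in>F-{k}. [:- x m, 1:])" for k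
  define s where "s = (\<Sum>k\<in>F. smult (poly p (x k) / (\<Prod>m\<in>F-{k}. x k - x m)) (L k))"
  have degL: "degree (L k) < card F" if "k \<in> F" for k
  proof -
    have "degree (L k) = card (F - {k})"
      unfolding L_def by (subst degree_prod_sum_eq) auto
    then show ?thesis using that F by (metis card_Diff1_less)
  qed
  have polyL: "poly (L k) w = (\<Prod>m\<in>F-{k}. w - x m)" for k w
    by (simp add: L_def poly_prod)
  have poly_s: "poly s w = (\<Sum>k\<in>F. poly p (x k) * (\<Prod>m\<in>F-{k}. (w - x m) / (x k - x m)))" for w
    by (simp add: s_def poly_sum polyL prod_dividef)
  have "F \<noteq> {}" using deg by auto
  then have degs: "degree s < card F"
    unfolding s_def using degL F
    by (intro degree_sum_less) (auto intro: le_less_trans[OF degree_smult_le] simp: card_gt_0_iff)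
  have "p = s"
  proof (rule poly_eqI_degree[where A = "x ` F"])
    fix y assume "y \<in> x ` F"
    then obtain j where j: "j \<in> F" "y = x j" by auto
    have "poly s y = (\<Sum>k\<in>F. if k = j then poly p (x j) else 0)"
      unfolding poly_s
    proof (intro sum.cong refl)
      fix k assume k: "k \<in> F"
      show "poly p (x k) * (\<Prod>m\<in>F-{k}. (y - x m) / (x k - x m)) = (if k = j then poly p (x j) else 0)"
      proof (cases "k = j")
        case True
        have "(\<Prod>m\<in>F-{k}. (y - x m) / (x k - x m)) = 1"
          using inj j k True by (intro prod.neutral) (auto dest: inj_onD)
        then show ?thesis using True by simp
      next
        case False
        then have "(\<Prod>m\<in>F-{k}. (y - x m) / (x k - x m)) = 0"
          using j F by (intro prod_zero) auto
        then show ?thesis using False by simp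
      qed
    qed
    then show "poly p y = poly s y" using j F by simp
  qed (use deg degs in \<open>simp_all add: card_image inj\<close>)
  then have "poly p z = poly s z" by simp
  then show ?thesis by (simp only: poly_s)
qed

text \<open>This is the explicit inverse of a Cauchy matrix. After cancellation the sum is the
  Lagrange expansion, at the nodes \<open>x k\<close>, of the product of \<open>X - z m\<close> over
  \<open>m \<noteq> j\<close>, evaluated at \<open>z l\<close> and divided by \<open>W\<close>. That
  polynomial vanishes at \<open>z l\<close> for every \<open>l \<noteq> j\<close>, whence the
  Kronecker delta.\<close>

lemma cauchy_matrix_orthogonality:
  fixes x z :: "'i \<Rightarrow> 'a::field"
  assumes F: "finite F" and inj: "inj_on x F"
    and ne: "\<And>j k. j \<in> F \<Longrightarrow> k \<in> F \<Longrightarrow> z j \<noteq> x k" and jl: "j \<in> F" "l \<in> F"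
  shows "(\<Sum>k\<in>F. (x k - z k) * (\<Prod>m\<in>F-{k}. (x k - z m) / (x k - x m)) / ((x k - z j) * (z l - x k)))
       = (if j = l then (\<Prod>m\<in>F-{j}. (z j - z m) / (z j - x m)) / (z j - x j) else 0)"
proof -
  define p where "p = (\<Prod>m\<in>F-{j}. [:- z m, 1:])"
  define W where "W = (\<Prod>m\<in>F. z l - x m)"
  have W: "W \<noteq> 0" using F ne jl by (auto simp: W_def)
  have polyp: "poly p w = (\<Prod>m\<in>F-{j}. w - z m)" for w
    by (simp add: p_def poly_prod)
  have degp: "degree p < card F"
  proof -
    have "degree p = card (F - {j})"
      unfolding p_def by (subst degree_prod_sum_eq) auto
    then show ?thesis using jl F by (metis card_Diff1_less)
  qed
  have term_eq: "(x k - z k) * (\<Prod>m\<in>F-{k}. (x k - z m) / (x k - x m)) / ((x k - z j) * (z l - x k))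
      = poly p (x k) * (\<Prod>m\<in>F-{k}. (z l - x m) / (x k - x m)) / W" if k: "k \<in> F" for k
  proof -
    have 1: "(x k - z k) * (\<Prod>m\<in>F-{k}. x k - z m) = (x k - z j) * (\<Prod>m\<in>F-{j}. x k - z m)"
      using prod.remove[OF F k, of "\<lambda>m. x k - z m"] prod.remove[OF F jl(1), of "\<lambda>m. x k - z m"] by simp
    have 2: "W = (z l - x k) * (\<Prod>m\<in>F-{k}. z l - x m)"
      unfolding W_def using prod.remove[OF F k] by simp
    have 4: "x k - z j \<noteq> 0" "z l - x k \<noteq> 0" using ne jl k by force+
    have 5: "(\<Prod>m\<in>F-{k}. z l - x m) \<noteq> 0" using W 2 by auto
    have cancel_left: "u * P / Q / (u * d) = P / Q / d" if "u \<noteq> 0" for u P Q d :: 'a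
      using that by simp
    have cancel_right: "P / Q / d = P * (R / Q) / (d * R)" if "R \<noteq> 0" for P Q R d :: 'a
      using that by simp
    have "(x k - z k) * (\<Prod>m\<in>F-{k}. (x k - z m) / (x k - x m)) / ((x k - z j) * (z l - x k))
       = ((x k - z k) * (\<Prod>m\<in>F-{k}. x k - z m)) / (\<Prod>m\<in>F-{k}. x k - x m) / ((x k - z j) * (z l - x k))"
      by (simp add: prod_dividef)
    also have "\<dots> = (\<Prod>m\<in>F-{j}. x k - z m) / (\<Prod>m\<in>F-{k}. x k - x m) / (z l - x k)"
      unfolding 1 using 4(1) by (rule cancel_left)
    also have "\<dots> = poly p (x k) * (\<Prod>m\<in>F-{k}. (z l - x m) / (x k - x m)) / W"
      unfolding 2 polyp prod_dividef using 5 by (rule cancel_right)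
    finally show ?thesis .
  qed
  have "(\<Sum>k\<in>F. (x k - z k) * (\<Prod>m\<in>F-{k}. (x k - z m) / (x k - x m)) / ((x k - z j) * (z l - x k)))
      = poly p (z l) / W"
    by (subst lagrange_interpolation[OF F inj degp, of "z l"])
      (simp add: term_eq sum_divide_distrib cong: sum.cong)
  also have "\<dots> = (if j = l then (\<Prod>m\<in>F-{j}. (z j - z m) / (z j - x m)) / (z j - x j) else 0)"
  proof (cases "j = l")
    case True
    have "W = (z j - x j) * (\<Prod>m\<in>F-{j}. z j - x m)"
      unfolding W_def True[symmetric] by (rule prod.remove[OF F jl(1)])
    then show ?thesis unfolding True[symmetric] polyp prod_dividef by simp
  next
    case False
    then have "poly p (z l) = 0" unfolding polyp using F jl by (intro prod_zero) auto
    then show ?thesis using False by simp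
  qed
  finally show ?thesis .
qed

section \<open>The half-plane kernel and its Blaschke products\<close>

text \<open>The inner product on the positive half-line of the unit vectors
  \<open>sqrt (2 * Im \<mu>) * exp (\<i> * \<mu> * t)\<close> and its analogue for
  \<open>\<nu>\<close>; equivalently, the normalised Szego kernel of the upper half-plane.\<close>

definition hardy_kernel :: "complex \<Rightarrow> complex \<Rightarrow> complex" where
  "hardy_kernel \<mu> \<nu> = 2 * \<i> * of_real (sqrt (Im \<mu> * Im \<nu>)) / (\<mu> - cnj \<nu>)"

text \<open>The value at \<open>\<mu> j\<close> of the finite Blaschke product with zeros at the
  other points of \<open>F\<close>.\<close>

definition blaschke :: "('i \<Rightarrow> complex) \<Rightarrow> 'i set \<Rightarrow> 'i \<Rightarrow> complex" where
  "blaschke \<mu> F j = (\<Prod>k\<in>F-{j}. (\<mu> j - \<mu> k) / (\<mu> j - cnj (\<mu> k)))"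

lemma upper_half_plane_neq_cnj: "Im \<mu> > 0 \<Longrightarrow> Im \<nu> > 0 \<Longrightarrow> \<mu> \<noteq> cnj \<nu>"
  by (auto simp: complex_eq_iff)

lemma hardy_kernel_cnj: "cnj (hardy_kernel \<mu> \<nu>) = hardy_kernel \<nu> \<mu>"
proof -
  have "cnj (hardy_kernel \<mu> \<nu>) = - (2 * \<i> * of_real (sqrt (Im \<nu> * Im \<mu>))) / - (\<nu> - cnj \<mu>)"
    by (simp add: hardy_kernel_def mult.commute)
  then show ?thesis
    by (simp only: minus_divide_divide hardy_kernel_def)
qed

lemma hardy_kernel_self: "Im \<mu> > 0 \<Longrightarrow> hardy_kernel \<mu> \<mu> = 1"
  by (simp add: hardy_kernel_def complex_diff_cnj)

text \<open>The identity |\<mu> - cnj \<nu>|^2 - |\<mu> - \<nu>|^2 = 4 Im \<mu> Im \<nu>, divided by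
  the first term. It turns small kernel entries into Blaschke factors close to modulus one.\<close>

lemma one_minus_pseudohyperbolic:
  assumes "Im \<mu> > 0" "Im \<nu> > 0"
  shows "1 - (cmod ((\<mu> - \<nu>) / (\<mu> - cnj \<nu>)))\<^sup>2 = (cmod (hardy_kernel \<mu> \<nu>))\<^sup>2"
proof -
  define P where "P = (cmod (\<mu> - cnj \<nu>))\<^sup>2"
  have P: "P \<noteq> 0" using upper_half_plane_neq_cnj[OF assms] by (simp add: P_def)
  have "P - (cmod (\<mu> - \<nu>))\<^sup>2 = 4 * (Im \<mu> * Im \<nu>)"
    unfolding P_def cmod_power2 minus_complex.sel cnj.sel by algebra
  then have Q: "(cmod (\<mu> - \<nu>))\<^sup>2 = P - 4 * (Im \<mu> * Im \<nu>)" by simp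
  have "(cmod (hardy_kernel \<mu> \<nu>))\<^sup>2 = 4 * (Im \<mu> * Im \<nu>) / P"
    using assms by (simp add: hardy_kernel_def norm_divide norm_mult power_divide power_mult_distrib P_def)
  then show ?thesis
    using P unfolding norm_divide power_divide P_def[symmetric] Q by (simp add: diff_divide_distrib)
qed

text \<open>Cauchy orthogonality with nodes \<open>cnj (\<mu> k)\<close> and points
  \<open>\<mu> k\<close>. The square roots of \<open>Im (\<mu> k)\<close> from the two kernels
  multiply to the factor \<open>cnj (\<mu> k) - \<mu> k\<close> up to a constant; those of
  \<open>j\<close> and \<open>l\<close> go into \<open>s\<close>, which for \<open>j = l\<close>
  cancels the remaining denominator.\<close>

lemma hardy_kernel_blaschke_orthogonality:
  assumes F: "finite F" and inj: "inj_on \<mu> F" and pos: "\<And>j. j \<in> F \<Longrightarrow> Im (\<mu> j) > 0"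
    and jl: "j \<in> F" "l \<in> F"
  shows "(\<Sum>k\<in>F. hardy_kernel (\<mu> j) (\<mu> k) * hardy_kernel (\<mu> l) (\<mu> k) / cnj (blaschke \<mu> F k))
       = (if j = l then blaschke \<mu> F j else 0)"
proof -
  define s where "s = 2 * \<i> * of_real (sqrt (Im (\<mu> j)) * sqrt (Im (\<mu> l)))"
  have term_eq: "hardy_kernel (\<mu> j) (\<mu> k) * hardy_kernel (\<mu> l) (\<mu> k) / cnj (blaschke \<mu> F k)
     = s * ((cnj (\<mu> k) - \<mu> k) * (\<Prod>m\<in>F-{k}. (cnj (\<mu> k) - \<mu> m) / (cnj (\<mu> k) - cnj (\<mu> m)))
        / ((cnj (\<mu> k) - \<mu> j) * (\<mu> l - cnj (\<mu> k))))" if k: "k \<in> F" for k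
  proof -
    have b: "1 / cnj (blaschke \<mu> F k) = (\<Prod>m\<in>F-{k}. (cnj (\<mu> k) - \<mu> m) / (cnj (\<mu> k) - cnj (\<mu> m)))"
      by (simp add: blaschke_def prod_dividef)
    have y: "cnj (\<mu> k) - \<mu> k = - 2 * \<i> * of_real (Im (\<mu> k))"
      by (simp add: complex_eq_iff)
    have "hardy_kernel (\<mu> j) (\<mu> k) * hardy_kernel (\<mu> l) (\<mu> k)
        = s * (cnj (\<mu> k) - \<mu> k) / ((cnj (\<mu> k) - \<mu> j) * (\<mu> l - cnj (\<mu> k)))"
    proof -
      have m: "cnj (\<mu> k) - \<mu> j = - (\<mu> j - cnj (\<mu> k))" by simp
      have "complex_of_real (sqrt (Im (\<mu> j) * Im (\<mu> k)) * sqrt (Im (\<mu> l) * Im (\<mu> k)))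
        = of_real (sqrt (Im (\<mu> j)) * sqrt (Im (\<mu> l)) * Im (\<mu> k))"
        using pos[OF k] by (simp add: real_sqrt_mult mult_ac flip: of_real_mult)
      then have "2 * \<i> * of_real (sqrt (Im (\<mu> j) * Im (\<mu> k))) * (2 * \<i> * of_real (sqrt (Im (\<mu> l) * Im (\<mu> k))))
        = s * (2 * \<i> * of_real (Im (\<mu> k)))"
        by (simp add: s_def)
      then have "hardy_kernel (\<mu> j) (\<mu> k) * hardy_kernel (\<mu> l) (\<mu> k)
        = s * (2 * \<i> * of_real (Im (\<mu> k))) / ((\<mu> j - cnj (\<mu> k)) * (\<mu> l - cnj (\<mu> k)))"
        by (simp only: hardy_kernel_def times_divide_times_eq)
      then show ?thesis
        unfolding y m by (simp del: minus_diff_eq)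
    qed
    then show ?thesis using b by (simp add: divide_inverse mult_ac)
  qed
  have inj': "inj_on (\<lambda>k. cnj (\<mu> k)) F" using inj by (auto simp: inj_on_def)
  have "(\<Sum>k\<in>F. hardy_kernel (\<mu> j) (\<mu> k) * hardy_kernel (\<mu> l) (\<mu> k) / cnj (blaschke \<mu> F k))
     = s * (if j = l then blaschke \<mu> F j / (\<mu> j - cnj (\<mu> j)) else 0)"
  proof -
    have "(\<Sum>k\<in>F. hardy_kernel (\<mu> j) (\<mu> k) * hardy_kernel (\<mu> l) (\<mu> k) / cnj (blaschke \<mu> F k))
      = s * (\<Sum>k\<in>F. (cnj (\<mu> k) - \<mu> k) * (\<Prod>m\<in>F-{k}. (cnj (\<mu> k) - \<mu> m) / (cnj (\<mu> k) - cnj (\<mu> m)))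
          / ((cnj (\<mu> k) - \<mu> j) * (\<mu> l - cnj (\<mu> k))))"
      unfolding sum_distrib_left by (intro sum.cong refl term_eq)
    also have "\<dots> = s * (if j = l then blaschke \<mu> F j / (\<mu> j - cnj (\<mu> j)) else 0)"
      unfolding blaschke_def
      by (subst cauchy_matrix_orthogonality[OF F inj' _ jl]) (use upper_half_plane_neq_cnj pos in auto)
    finally show ?thesis .
  qed
  also have "\<dots> = (if j = l then blaschke \<mu> F j else 0)"
  proof (cases "j = l")
    case True
    have "s = \<mu> j - cnj (\<mu> j)"
      using pos[OF jl(1)] unfolding s_def True[symmetric] by (simp add: complex_diff_cnj)
    moreover have "\<mu> j - cnj (\<mu> j) \<noteq> 0"
      using upper_half_plane_neq_cnj[OF pos pos, OF jl(1) jl(1)] by simp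
    ultimately show ?thesis using True by simp
  qed simp
  finally show ?thesis .
qed

section \<open>Hermitian forms\<close>

text \<open>If \<open>G\<close> is a Gram matrix, the value at \<open>c\<close>, \<open>c\<close> is
  the squared norm of the combination with coefficients \<open>c\<close>. For Hermitian
  \<open>G\<close> this value is real, so taking \<open>Re\<close> below loses nothing.\<close>

definition hform :: "('i \<Rightarrow> 'i \<Rightarrow> complex) \<Rightarrow> 'i set \<Rightarrow> ('i \<Rightarrow> complex) \<Rightarrow> ('i \<Rightarrow> complex) \<Rightarrow> complex" where
  "hform G F c d = (\<Sum>j\<in>F. \<Sum>k\<in>F. c j * cnj (d k) * G j k)"

lemma hform_cnj:
  assumes "\<And>j k. cnj (G j k) = G k j"
  shows "cnj (hform G F c d) = hform G F d c"
proof -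
  have "cnj (hform G F c d) = (\<Sum>j\<in>F. \<Sum>k\<in>F. d k * cnj (c j) * G k j)"
    by (simp add: hform_def assms mult_ac)
  also have "\<dots> = hform G F d c"
    unfolding hform_def by (rule sum.swap)
  finally show ?thesis .
qed

text \<open>The polynomial in \<open>t\<close> behind the Cauchy-Schwarz inequality. Below,
  positivity is applied at one explicit \<open>t\<close>, which avoids dividing by a value of the
  form.\<close>

lemma hform_diff_scaled:
  assumes "\<And>j k. cnj (G j k) = G k j"
  shows "Re (hform G F (\<lambda>j. c j - of_real t * d j) (\<lambda>j. c j - of_real t * d j))
     = Re (hform G F c c) - 2 * t * Re (hform G F c d) + t\<^sup>2 * Re (hform G F d d)"
proof -
  have expand: "hform G F (\<lambda>j. c j - of_real t * d j) (\<lambda>j. c j - of_real t * d j)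
    = hform G F c c - of_real t * hform G F c d - of_real t * hform G F d c + of_real (t\<^sup>2) * hform G F d d"
    unfolding hform_def sum_distrib_left
    by (simp add: algebra_simps power2_eq_square flip: sum.distrib sum_subtractf)
  have "Re (hform G F d c) = Re (hform G F c d)"
    using arg_cong[OF hform_cnj[of G F d c, OF assms], of Re] by simp
  then show ?thesis unfolding expand by (simp add: algebra_simps del: of_real_power)
qed

text \<open>Cauchy-Schwarz for the form between the row \<open>G j\<close> and the unit vector
  \<open>e\<close>: their pairing is the row sum \<open>S\<close>, while the diagonal values are at
  most \<open>B * S\<close> and equal to 1.\<close>

lemma hform_row_bound:
  assumes herm: "\<And>j k. cnj (G j k) = G k j"
    and psd: "\<And>c. 0 \<le> Re (hform G F c c)"
    and upper: "\<And>c. Re (hform G F c c) \<le> B * (\<Sum>j\<in>F. (cmod (c j))\<^sup>2)"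
    and B: "B > 0" and F: "finite F" and j: "j \<in> F" and one: "G j j = 1"
  shows "(\<Sum>k\<in>F. (cmod (G j k))\<^sup>2) \<le> B"
proof -
  define S where "S = (\<Sum>k\<in>F. (cmod (G j k))\<^sup>2)"
  define e where "e k = (if k = j then 1 else 0 :: complex)" for k
  have sq: "G j k * G k j = of_real ((cmod (G j k))\<^sup>2)" for k
    by (simp only: complex_norm_square herm)
  have "hform G F (G j) e = (\<Sum>m\<in>F. \<Sum>k\<in>F. if k = j then G j m * G m j else 0)"
    unfolding hform_def e_def by (intro sum.cong refl) auto
  also have "\<dots> = of_real S"
    using F j by (simp add: sq S_def)
  finally have 1: "hform G F (G j) e = of_real S" .
  have "hform G F e e = (\<Sum>m\<in>F. \<Sum>k\<in>F. if k = j then if m = j then 1 else 0 else 0)"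
    unfolding hform_def e_def by (intro sum.cong refl) (auto simp: one)
  also have "\<dots> = 1" using F j by simp
  finally have 2: "hform G F e e = 1" .
  have "0 \<le> Re (hform G F (G j) (G j)) - 2 * B * S + B\<^sup>2"
    using psd[of "\<lambda>k. G j k - of_real B * e k"] unfolding hform_diff_scaled[OF herm] 1 2 by simp
  also have "\<dots> \<le> B * S - 2 * B * S + B\<^sup>2"
    using upper[of "G j"] by (simp add: S_def)
  finally have "B * S \<le> B * B" by (simp add: power2_eq_square)
  then show ?thesis using B by (simp add: S_def)
qed

text \<open>\<open>orth\<close> exhibits an inverse of \<open>G\<close> built from the transpose of
  \<open>G\<close> and two diagonal matrices with entries of modulus at most
  \<open>1 / sqrt s\<close>. Its norm is thus at most \<open>B / s\<close>, and a positive form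
  whose inverse is so bounded is at least \<open>s / B\<close>.\<close>

lemma hform_lower_bound:
  assumes herm: "\<And>j k. cnj (G j k) = G k j"
    and psd: "\<And>c. 0 \<le> Re (hform G F c c)"
    and upper: "\<And>c. Re (hform G F c c) \<le> B * (\<Sum>j\<in>F. (cmod (c j))\<^sup>2)"
    and B: "B > 0" and F: "finite F" and s: "s > 0"
    and beta: "\<And>j. j \<in> F \<Longrightarrow> s \<le> (cmod (\<beta> j))\<^sup>2"
    and orth: "\<And>j l. j \<in> F \<Longrightarrow> l \<in> F \<Longrightarrow>
      (\<Sum>k\<in>F. G j k * G l k / cnj (\<beta> k)) = (if j = l then \<beta> j else 0)"
  shows "s / B * (\<Sum>j\<in>F. (cmod (c j))\<^sup>2) \<le> Re (hform G F c c)"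
proof -
  define S where "S = (\<Sum>j\<in>F. (cmod (c j))\<^sup>2)"
  define d where "d k = cnj (\<Sum>l\<in>F. G l k * cnj (c l) / (\<beta> l * cnj (\<beta> k)))" for k
  have b0: "\<beta> j \<noteq> 0" if "j \<in> F" for j using beta[OF that] s by auto
  have dual: "hform G F x d = (\<Sum>j\<in>F. x j * cnj (c j))" for x
    \<comment> \<open>\<open>d\<close> is the solution of the linear system with right-hand side \<open>c\<close>, by the explicit inverse.\<close>
  proof -
    have "hform G F x d = (\<Sum>j\<in>F. \<Sum>k\<in>F. \<Sum>l\<in>F. x j * (cnj (c l) / \<beta> l) * (G j k * G l k / cnj (\<beta> k)))"
      unfolding hform_def d_def complex_cnj_cnj
      by (simp add: sum_distrib_left sum_distrib_right divide_inverse mult_ac)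
    also have "\<dots> = (\<Sum>j\<in>F. \<Sum>l\<in>F. x j * (cnj (c l) / \<beta> l) * (\<Sum>k\<in>F. G j k * G l k / cnj (\<beta> k)))"
      unfolding sum_distrib_left by (intro sum.cong refl sum.swap)
    also have "\<dots> = (\<Sum>j\<in>F. \<Sum>l\<in>F. if j = l then x j * cnj (c j) else 0)"
      by (intro sum.cong refl) (use b0 in \<open>auto simp: orth\<close>)
    also have "\<dots> = (\<Sum>j\<in>F. x j * cnj (c j))" using F by simp
    finally show ?thesis .
  qed
  have cd: "hform G F c d = of_real S"
    unfolding dual S_def by (simp add: complex_norm_square[symmetric])
  \<comment> \<open>The inverse again contains \<open>G\<close>, so the value of the form at the
    solution \<open>d\<close> is its value at the rescaled vector \<open>v\<close>, where the upper
    bound applies a second time.\<close>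
  define v where "v j = cnj (c j) / \<beta> j" for j
  have "hform G F d d = (\<Sum>j\<in>F. d j * cnj (c j))" by (rule dual)
  also have "\<dots> = hform G F v v"
    unfolding hform_def d_def v_def
    by (simp add: sum_distrib_left sum_distrib_right herm divide_inverse mult_ac)
  finally have "Re (hform G F d d) \<le> B * (\<Sum>j\<in>F. (cmod (v j))\<^sup>2)"
    using upper by simp
  also have "(\<Sum>j\<in>F. (cmod (v j))\<^sup>2) \<le> (\<Sum>j\<in>F. (cmod (c j))\<^sup>2 / s)"
  proof (rule sum_mono)
    fix j assume "j \<in> F"
    then have "(cmod (c j))\<^sup>2 / (cmod (\<beta> j))\<^sup>2 \<le> (cmod (c j))\<^sup>2 / s"
      using beta s by (intro divide_left_mono) (auto intro!: mult_pos_pos simp: b0)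
    then show "(cmod (v j))\<^sup>2 \<le> (cmod (c j))\<^sup>2 / s"
      by (simp add: v_def norm_divide power_divide)
  qed
  finally have dd: "Re (hform G F d d) \<le> B * (S / s)"
    using B by (simp add: S_def sum_divide_distrib)
  \<comment> \<open>This \<open>t\<close> minimises the quadratic
    \<open>- 2 * t * S + t\<^sup>2 * B * S / s\<close>.\<close>
  define t where "t = s / B"
  have "0 \<le> Re (hform G F c c) - 2 * t * S + t\<^sup>2 * Re (hform G F d d)"
    using psd[of "\<lambda>k. c k - of_real t * d k"] unfolding hform_diff_scaled[OF herm] cd by simp
  also have "\<dots> \<le> Re (hform G F c c) - 2 * t * S + t\<^sup>2 * (B * (S / s))"
    using mult_left_mono[OF dd, of "t\<^sup>2"] by simp
  also have "t\<^sup>2 * (B * (S / s)) = t * S"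
    using B s by (simp add: t_def power2_eq_square field_simps)
  finally show ?thesis by (simp add: t_def S_def)
qed

text \<open>A crude bound depending on \<open>F\<close> and \<open>G\<close>. It serves only to make
  the remainder of a telescoping series vanish and does not enter the resulting estimates.\<close>

lemma hform_bounded:
  assumes F: "finite F"
  obtains M where "\<And>c. \<bar>Re (hform G F c c)\<bar> \<le> M * (\<Sum>j\<in>F. (cmod (c j))\<^sup>2)"
proof -
  have "\<bar>Re (hform G F c c)\<bar> \<le> (\<Sum>j\<in>F. \<Sum>k\<in>F. cmod (G j k)) * (\<Sum>j\<in>F. (cmod (c j))\<^sup>2)" for c
  proof -
    define S where "S = (\<Sum>j\<in>F. (cmod (c j))\<^sup>2)"
    have S: "cmod (c j) * cmod (c k) \<le> S" if "j \<in> F" "k \<in> F" for j k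
    proof -
      have "(cmod (c j))\<^sup>2 \<le> S" "(cmod (c k))\<^sup>2 \<le> S"
        unfolding S_def using F that by (auto intro: member_le_sum)
      moreover have "2 * (cmod (c j) * cmod (c k)) \<le> (cmod (c j))\<^sup>2 + (cmod (c k))\<^sup>2"
        using sum_squares_bound[of "cmod (c j)" "cmod (c k)"] by simp
      ultimately show ?thesis by linarith
    qed
    have "\<bar>Re (hform G F c c)\<bar> \<le> cmod (hform G F c c)" by (rule abs_Re_le_cmod)
    also have "\<dots> \<le> (\<Sum>j\<in>F. \<Sum>k\<in>F. cmod (G j k) * S)"
      unfolding hform_def
    proof (intro sum_norm_le)
      fix j k assume "j \<in> F" "k \<in> F"
      then show "cmod (c j * cnj (c k) * G j k) \<le> cmod (G j k) * S"
        using mult_right_mono[OF S, of j k "cmod (G j k)"] by (simp add: norm_mult mult_ac)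
    qed
    finally show ?thesis by (simp add: S_def sum_distrib_right)
  qed
  then show ?thesis by (rule that)
qed

text \<open>The form is the sum of the telescoping series of its increments along \<open>b, bE, bE\<^sup>2, \<dots>\<close>.\<close>

lemma hform_bounds_from_contraction:
  assumes F: "finite F" and q: "0 \<le> q" "q < 1" and C: "0 \<le> C"
    and E: "\<And>j. j \<in> F \<Longrightarrow> (cmod (E j))\<^sup>2 \<le> q"
    and low: "\<And>b. Re (hform G F (\<lambda>j. b j * E j) (\<lambda>j. b j * E j)) \<le> Re (hform G F b b)"
    and up: "\<And>b. Re (hform G F b b) - Re (hform G F (\<lambda>j. b j * E j) (\<lambda>j. b j * E j))
        \<le> C * (\<Sum>j\<in>F. (cmod (b j))\<^sup>2)"
  shows "0 \<le> Re (hform G F b b)"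
    and "Re (hform G F b b) \<le> C / (1 - q) * (\<Sum>j\<in>F. (cmod (b j))\<^sup>2)"
proof -
  define Q where "Q n = Re (hform G F (\<lambda>j. b j * E j ^ n) (\<lambda>j. b j * E j ^ n))" for n
  define S where "S = (\<Sum>j\<in>F. (cmod (b j))\<^sup>2)"
  have S0: "0 \<le> S" by (simp add: S_def sum_nonneg)
  have Sn: "(\<Sum>j\<in>F. (cmod (b j * E j ^ n))\<^sup>2) \<le> q ^ n * S" for n
    unfolding S_def sum_distrib_left
  proof (rule sum_mono)
    fix j assume "j \<in> F"
    then have "((cmod (E j))\<^sup>2) ^ n \<le> q ^ n" using E by (intro power_mono) auto
    then show "(cmod (b j * E j ^ n))\<^sup>2 \<le> q ^ n * (cmod (b j))\<^sup>2"
      using mult_left_mono[of "((cmod (E j))\<^sup>2) ^ n" "q ^ n" "(cmod (b j))\<^sup>2"]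
      by (simp add: norm_mult norm_power power_mult_distrib mult.commute flip: power_mult)
  qed
  obtain M where M: "\<And>c. \<bar>Re (hform G F c c)\<bar> \<le> M * (\<Sum>j\<in>F. (cmod (c j))\<^sup>2)"
    using hform_bounded[OF F] by blast
  have absQ: "\<bar>Q n\<bar> \<le> \<bar>M\<bar> * (q ^ n * S)" for n
  proof -
    have "\<bar>Q n\<bar> \<le> M * (\<Sum>j\<in>F. (cmod (b j * E j ^ n))\<^sup>2)" unfolding Q_def by (rule M)
    also have "\<dots> \<le> \<bar>M\<bar> * (\<Sum>j\<in>F. (cmod (b j * E j ^ n))\<^sup>2)"
      by (intro mult_right_mono) (auto intro: sum_nonneg)
    also have "\<dots> \<le> \<bar>M\<bar> * (q ^ n * S)" by (intro mult_left_mono Sn) auto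
    finally show ?thesis .
  qed
  have qn: "(\<lambda>n. q ^ n) \<longlonglongrightarrow> 0" using q by (intro LIMSEQ_power_zero) simp
  have g: "(\<lambda>n. \<bar>M\<bar> * (q ^ n * S)) \<longlonglongrightarrow> 0"
    by (rule tendsto_mult_right_zero[OF tendsto_mult_left_zero[OF qn]])
  have lim: "Q \<longlonglongrightarrow> 0"
    by (rule Lim_null_comparison[OF always_eventually g]) (simp add: absQ)
  have step: "Q (Suc n) \<le> Q n" "Q n \<le> C * (q ^ n * S) + Q (Suc n)" for n
  proof -
    show "Q (Suc n) \<le> Q n"
      using low[of "\<lambda>j. b j * E j ^ n"] by (simp add: Q_def mult_ac)
    have "Q n - Q (Suc n) \<le> C * (\<Sum>j\<in>F. (cmod (b j * E j ^ n))\<^sup>2)"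
      using up[of "\<lambda>j. b j * E j ^ n"] by (simp add: Q_def mult_ac)
    also have "\<dots> \<le> C * (q ^ n * S)" using C Sn by (intro mult_left_mono) auto
    finally show "Q n \<le> C * (q ^ n * S) + Q (Suc n)" by simp
  qed
  have Q0: "Q 0 = Re (hform G F b b)" by (simp add: Q_def)
  have "decseq Q" using step(1) by (simp add: decseq_Suc_iff)
  then show "0 \<le> Re (hform G F b b)" using decseq_ge[OF _ lim, of 0] Q0 by simp
  \<comment> \<open>Partial sum of the increments:
    \<open>C * S * (1 + q + ... + q ^ (n - 1))\<close> in closed form, plus the remainder
    \<open>Q n\<close>.\<close>
  have up_n: "Q 0 \<le> C / (1 - q) * S * (1 - q ^ n) + Q n" for n
  proof (induction n)
    case (Suc n)
    have "C / (1 - q) * S * (1 - q ^ n) + C * (q ^ n * S) = C / (1 - q) * S * (1 - q ^ Suc n)"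
      using q by (simp add: field_simps)
    then show ?case using Suc step(2)[of n] by linarith
  qed simp
  have "(\<lambda>n. C / (1 - q) * S * (1 - q ^ n) + Q n) \<longlonglongrightarrow> C / (1 - q) * S * (1 - 0) + 0"
    by (intro tendsto_intros lim qn)
  then have "Q 0 \<le> C / (1 - q) * S * (1 - 0) + 0"
    by (rule LIMSEQ_le_const) (use up_n in auto)
  then show "Re (hform G F b b) \<le> C / (1 - q) * (\<Sum>j\<in>F. (cmod (b j))\<^sup>2)"
    by (simp add: Q0 S_def)
qed

section \<open>Lower bound for the half-plane form\<close>

text \<open>Each squared factor of the Blaschke product is one minus a squared kernel entry, so the
  Weierstrass inequality bounds the product below by one minus the row sum.\<close>

lemma blaschke_lower_bound:
  assumes F: "finite F" and j: "j \<in> F" and pos: "\<And>k. k \<in> F \<Longrightarrow> Im (\<mu> k) > 0"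
    and small: "(\<Sum>k\<in>F-{j}. (cmod (hardy_kernel (\<mu> j) (\<mu> k)))\<^sup>2) \<le> r"
  shows "1 - r \<le> (cmod (blaschke \<mu> F j))\<^sup>2"
proof -
  have x: "1 - (cmod (hardy_kernel (\<mu> j) (\<mu> k)))\<^sup>2 = (cmod ((\<mu> j - \<mu> k) / (\<mu> j - cnj (\<mu> k))))\<^sup>2"
    if "k \<in> F" for k
    using one_minus_pseudohyperbolic[of "\<mu> j" "\<mu> k"] pos j that by simp
  have le1: "(cmod (hardy_kernel (\<mu> j) (\<mu> k)))\<^sup>2 \<le> 1" if "k \<in> F" for k
    using x[OF that] by (metis diff_ge_0_iff_ge zero_le_power2)
  have "1 - r \<le> 1 - (\<Sum>k\<in>F-{j}. (cmod (hardy_kernel (\<mu> j) (\<mu> k)))\<^sup>2)" using small by simp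
  also have "\<dots> \<le> (\<Prod>k\<in>F-{j}. 1 - (cmod (hardy_kernel (\<mu> j) (\<mu> k)))\<^sup>2)"
    using le1 by (intro Weierstrass_prod_ineq) auto
  also have "\<dots> = (\<Prod>k\<in>F-{j}. (cmod ((\<mu> j - \<mu> k) / (\<mu> j - cnj (\<mu> k))))\<^sup>2)"
    using x by (intro prod.cong) auto
  also have "\<dots> = (cmod (blaschke \<mu> F j))\<^sup>2"
    unfolding blaschke_def by (simp add: prod_norm[symmetric] prod_power_distrib)
  finally show ?thesis .
qed

lemma hardy_form_lower_bound:
  fixes \<mu> :: "'i \<Rightarrow> complex" and F :: "'i set"
  defines "Q \<equiv> \<lambda>b. Re (hform (\<lambda>j k. hardy_kernel (\<mu> j) (\<mu> k)) F b b)"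
  assumes F: "finite F" and pos: "\<And>k. k \<in> F \<Longrightarrow> Im (\<mu> k) > 0"
    and psd: "\<And>b. 0 \<le> Q b"
    and upper: "\<And>b. Q b \<le> B * (\<Sum>j\<in>F. (cmod (b j))\<^sup>2)" and B: "B > 0"
    and small: "\<And>j. j \<in> F \<Longrightarrow> (\<Sum>k\<in>F-{j}. (cmod (hardy_kernel (\<mu> j) (\<mu> k)))\<^sup>2) \<le> 1/2"
  shows "(\<Sum>j\<in>F. (cmod (b j))\<^sup>2) / (2 * B) \<le> Q b"
proof -
  \<comment> \<open>A repeated point would produce an off-diagonal entry of modulus 1, more than a
    row sum of \<open>1/2\<close> permits.\<close>
  have inj: "inj_on \<mu> F"
  proof (rule inj_onI, rule ccontr)
    fix j k assume jk: "j \<in> F" "k \<in> F" "\<mu> j = \<mu> k" "j \<noteq> k"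
    then have "1 = (cmod (hardy_kernel (\<mu> j) (\<mu> k)))\<^sup>2"
      using hardy_kernel_self[OF pos] by simp
    also have "\<dots> \<le> (\<Sum>k\<in>F-{j}. (cmod (hardy_kernel (\<mu> j) (\<mu> k)))\<^sup>2)"
      using F jk by (intro member_le_sum) auto
    also have "\<dots> \<le> 1/2" using small jk(1) by blast
    finally show False by simp
  qed
  have "1/2 / B * (\<Sum>j\<in>F. (cmod (b j))\<^sup>2) \<le> Q b"
    unfolding Q_def
  proof (rule hform_lower_bound[where \<beta> = "blaschke \<mu> F"])
    show "1/2 \<le> (cmod (blaschke \<mu> F j))\<^sup>2" if "j \<in> F" for j
      using blaschke_lower_bound[OF F that, of \<mu> "1/2"] pos small[OF that] by simp
  qed (use assms hardy_kernel_blaschke_orthogonality[OF F inj pos] hardy_kernel_cnj in auto)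
  then show ?thesis by simp
qed

section \<open>Balanced colourings\<close>

text \<open>A colouring minimising the total weight of the monochromatic pairs cannot be improved by
  recolouring a single vertex, so the colour of a vertex carries at most the average weight.\<close>

lemma finite_balanced_colouring:
  fixes w :: "'i \<Rightarrow> 'i \<Rightarrow> real"
  assumes F: "finite F" and sym: "\<And>j k. w j k = w k j" and m: "m > 0"
    and bound: "\<And>j. j \<in> F \<Longrightarrow> (\<Sum>k\<in>F-{j}. w j k) \<le> B"
  obtains col :: "'i \<Rightarrow> nat" where "\<And>j. j \<in> F \<Longrightarrow> col j < m"
    and "\<And>j. j \<in> F \<Longrightarrow> (\<Sum>k\<in>F-{j}. if col k = col j then w j k else 0) \<le> B / real m"
proof -
  define mono :: "'i set \<Rightarrow> ('i \<Rightarrow> nat) \<Rightarrow> real" where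
    "mono A col = (\<Sum>j\<in>A. \<Sum>k\<in>A-{j}. if col k = col j then w j k else 0)" for A col
  \<comment> \<open>\<open>mono\<close> runs over ordered pairs, so by symmetry the pairs that
    contain \<open>j\<close> count twice.\<close>
  have split: "mono F col = mono (F-{j}) col + 2 * (\<Sum>k\<in>F-{j}. if col k = col j then w j k else 0)"
    if j: "j \<in> F" for col j
  proof -
    have "mono F col = (\<Sum>k\<in>F-{j}. if col k = col j then w j k else 0)
       + (\<Sum>i\<in>F-{j}. \<Sum>k\<in>F-{i}. if col k = col i then w i k else 0)"
      unfolding mono_def using sum.remove[OF F j] by simp
    also have "(\<Sum>i\<in>F-{j}. \<Sum>k\<in>F-{i}. if col k = col i then w i k else 0)
       = (\<Sum>i\<in>F-{j}. (if col i = col j then w j i else 0) + (\<Sum>k\<in>F-{j}-{i}. if col k = col i then w i k else 0))"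
    proof (intro sum.cong refl)
      fix i assume "i \<in> F-{j}"
      then have "(\<Sum>k\<in>F-{i}. if col k = col i then w i k else 0)
        = (if col j = col i then w i j else 0) + (\<Sum>k\<in>F-{i}-{j}. if col k = col i then w i k else 0)"
        using F j by (intro sum.remove) auto
      moreover have "F-{i}-{j} = F-{j}-{i}" by auto
      ultimately show "(\<Sum>k\<in>F-{i}. if col k = col i then w i k else 0)
        = (if col i = col j then w j i else 0) + (\<Sum>k\<in>F-{j}-{i}. if col k = col i then w i k else 0)"
        by (simp only: sym[of i j] eq_commute[of "col j" "col i"])
    qed
    finally show ?thesis by (simp add: sum.distrib mono_def)
  qed
  have fin: "finite (PiE F (\<lambda>_. {..<m}))" using F by (intro finite_PiE) auto
  have ne: "PiE F (\<lambda>_. {..<m}) \<noteq> {}" using m by (auto simp: PiE_eq_empty_iff lessThan_empty_iff)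
  obtain col where col: "col \<in> PiE F (\<lambda>_. {..<m})"
    and min: "\<And>\<psi>. \<psi> \<in> PiE F (\<lambda>_. {..<m}) \<Longrightarrow> mono F col \<le> mono F \<psi>"
    using ex_is_arg_min_if_finite[OF fin ne, of "mono F"]
    by (auto simp: is_arg_min_def not_less)
  show ?thesis
  proof (rule that)
    show "col j < m" if "j \<in> F" for j using col that by (auto dest: PiE_mem)
    fix j assume j: "j \<in> F"
    define S where "S = (\<Sum>k\<in>F-{j}. if col k = col j then w j k else 0)"
    have le: "S \<le> (\<Sum>k\<in>F-{j}. if col k = c then w j k else 0)" if c: "c < m" for c
    proof -
      have "col(j := c) \<in> PiE F (\<lambda>_. {..<m})" using col c j by (auto simp: PiE_iff extensional_def)
      then have "mono F col \<le> mono F (col(j := c))" by (rule min)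
      moreover have "mono (F-{j}) (col(j := c)) = mono (F-{j}) col"
        unfolding mono_def by (intro sum.cong refl) auto
      moreover have "(\<Sum>k\<in>F-{j}. if (col(j := c)) k = (col(j := c)) j then w j k else 0)
         = (\<Sum>k\<in>F-{j}. if col k = c then w j k else 0)"
        by (intro sum.cong refl) auto
      ultimately show ?thesis using split[OF j, of col] split[OF j, of "col(j := c)"] by (simp add: S_def)
    qed
    \<comment> \<open>Summing over all target colours recovers the full row sum, since every vertex
      has exactly one colour below \<open>m\<close>.\<close>
    have "real m * S = (\<Sum>c<m. S)" by simp
    also have "\<dots> \<le> (\<Sum>c<m. \<Sum>k\<in>F-{j}. if col k = c then w j k else 0)"
      using le by (intro sum_mono) auto
    also have "\<dots> = (\<Sum>k\<in>F-{j}. \<Sum>c<m. if col k = c then w j k else 0)"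
      by (rule sum.swap)
    also have "\<dots> = (\<Sum>k\<in>F-{j}. w j k)"
      using col by (intro sum.cong refl) (auto dest: PiE_mem)
    also have "\<dots> \<le> B" using bound j by simp
    finally show "S \<le> B / real m" using m by (simp add: field_simps)
  qed
qed

text \<open>Sequential compactness of the space of colourings with \<open>m\<close> colours: a
  cluster point in the product topology, obtained by repeated pigeonhole selection of nested
  infinite index sets.\<close>

lemma pointwise_cluster_colouring:
  fixes col :: "nat \<Rightarrow> nat \<Rightarrow> nat"
  assumes "\<And>n k. col n k < m"
  obtains \<psi> where "\<And>k. \<psi> k < m" and "\<And>k N. \<exists>n\<ge>N. \<forall>i<k. col n i = \<psi> i"
proof -
  define P where "P k T \<longleftrightarrow> infinite T \<and> (\<forall>i<k. \<exists>v. \<forall>n\<in>T. col n i = v)" for k :: nat and T :: "nat set"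
  have "\<exists>T. \<forall>k. P k (T k) \<and> T (Suc k) \<subseteq> T k"
  proof (rule dependent_nat_choice)
    show "\<exists>T. P 0 T" by (auto simp: P_def intro: infinite_UNIV_nat)
    fix T k assume P: "P k T"
    have fin: "finite ((\<lambda>n. col n k) ` T)" using assms by (auto intro: finite_subset[of _ "{..<m}"])
    obtain n0 where "n0 \<in> T" "infinite {n\<in>T. col n k = col n0 k}"
      using pigeonhole_infinite[OF _ fin] P by (auto simp: P_def)
    moreover from this have "P (Suc k) {n\<in>T. col n k = col n0 k}"
      using P by (auto simp: P_def less_Suc_eq)
    ultimately show "\<exists>T'. P (Suc k) T' \<and> T' \<subseteq> T" by blast
  qed
  then obtain T where T: "\<And>k. P k (T k)" and sub: "\<And>k. T (Suc k) \<subseteq> T k" by blast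
  have dec: "T k \<subseteq> T i" if "i \<le> k" for i k
    using lift_Suc_antimono_le[of T, OF sub that] .
  have "\<forall>i. \<exists>v. \<forall>n\<in>T (Suc i). col n i = v" using T by (auto simp: P_def)
  then obtain \<psi> where \<psi>: "\<And>i n. n \<in> T (Suc i) \<Longrightarrow> col n i = \<psi> i" by metis
  have ex: "\<exists>n\<ge>N. n \<in> T k" for k N
    using T[of k] by (auto simp: P_def infinite_nat_iff_unbounded_le)
  show ?thesis
  proof (rule that)
    show "\<psi> k < m" for k 
    proof -
      obtain n where "n \<in> T (Suc k)" using ex by blast
      then show ?thesis using \<psi>[of n k] assms[of n k] by simp
    qed
    show "\<exists>n\<ge>N. \<forall>i<k. col n i = \<psi> i" for k N
    proof -
      obtain n where n: "n \<ge> N" "n \<in> T k" using ex by blast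
      have "col n i = \<psi> i" if "i < k" for i
        using \<psi>[of n i] dec[of "Suc i" k] n(2) that by auto
      then show ?thesis using n(1) by blast
    qed
  qed
qed

text \<open>Compactness extends the finite result to infinite \<open>I\<close>. The initial segments
  of \<open>I\<close> are balanced with the same \<open>B / real m\<close>, and the condition on a
  finite \<open>F\<close> involves only finitely many colours, so it passes to a cluster
  point.\<close>

lemma balanced_colouring:
  fixes w :: "nat \<Rightarrow> nat \<Rightarrow> real"
  assumes sym: "\<And>j k. w j k = w k j" and nonneg: "\<And>j k. w j k \<ge> 0" and m: "m > 0"
    and bound: "\<And>F j. finite F \<Longrightarrow> F \<subseteq> I \<Longrightarrow> j \<in> F \<Longrightarrow> (\<Sum>k\<in>F-{j}. w j k) \<le> B"
  obtains col :: "nat \<Rightarrow> nat" where "\<And>j. col j < m"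
    and "\<And>F j. finite F \<Longrightarrow> F \<subseteq> I \<Longrightarrow> j \<in> F \<Longrightarrow> (\<And>k. k \<in> F \<Longrightarrow> col k = col j)
      \<Longrightarrow> (\<Sum>k\<in>F-{j}. w j k) \<le> B / real m"
proof -
  have "\<exists>col. (\<forall>j. col j < m) \<and> (\<forall>j\<in>I \<inter> {..<n}.
     (\<Sum>k\<in>I \<inter> {..<n}-{j}. if col k = col j then w j k else 0) \<le> B / real m)" for n
  proof -
    obtain col :: "nat \<Rightarrow> nat" where col: "\<And>j. j \<in> I \<inter> {..<n} \<Longrightarrow> col j < m"
      "\<And>j. j \<in> I \<inter> {..<n} \<Longrightarrow>
        (\<Sum>k\<in>I \<inter> {..<n}-{j}. if col k = col j then w j k else 0) \<le> B / real m"
    proof (rule finite_balanced_colouring[of "I \<inter> {..<n}" w m B])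
      show "(\<Sum>k\<in>I \<inter> {..<n}-{j}. w j k) \<le> B" if "j \<in> I \<inter> {..<n}" for j
        using that by (intro bound) auto
    qed (use sym m in auto)
    \<comment> \<open>Colour 0 outside the segment keeps all colours below \<open>m\<close>, as the
      compactness argument requires.\<close>
    define col' where "col' j = (if j \<in> I \<inter> {..<n} then col j else 0)" for j
    have "(\<Sum>k\<in>I \<inter> {..<n}-{j}. if col' k = col' j then w j k else 0)
      = (\<Sum>k\<in>I \<inter> {..<n}-{j}. if col k = col j then w j k else 0)" if "j \<in> I \<inter> {..<n}" for j
      using that by (intro sum.cong refl) (auto simp: col'_def)
    then show ?thesis using col m by (intro exI[of _ col']) (auto simp: col'_def)
  qed
  then obtain X :: "nat \<Rightarrow> nat \<Rightarrow> nat" where Xm: "\<And>n j. X n j < m"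
    and X: "\<And>n j. j \<in> I \<inter> {..<n} \<Longrightarrow>
      (\<Sum>k\<in>I \<inter> {..<n}-{j}. if X n k = X n j then w j k else 0) \<le> B / real m"
    by metis
  obtain \<psi> where \<psi>: "\<And>k. \<psi> k < m" "\<And>k N. \<exists>n\<ge>N. \<forall>i<k. X n i = \<psi> i"
    using pointwise_cluster_colouring[of X m] Xm by blast
  show ?thesis
  proof (rule that[of \<psi>])
    show "\<psi> j < m" for j by (rule \<psi>)
    fix F j assume F: "finite F" "F \<subseteq> I" "j \<in> F" and same: "\<And>k. k \<in> F \<Longrightarrow> \<psi> k = \<psi> j"
    obtain N where N: "F \<subseteq> {..<N}" using F(1) by (meson finite_nat_bounded)
    obtain n where n: "n \<ge> N" "\<And>i. i < N \<Longrightarrow> X n i = \<psi> i" using \<psi>(2) by blast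
    have Fn: "F \<subseteq> {..<n}" using N n(1) by auto
    have XF: "X n k = X n j" if "k \<in> F" for k
      using n(2) same that N F(3) by (metis lessThan_iff subsetD)
    \<comment> \<open>\<open>X n\<close> agrees with \<open>\<psi>\<close> on \<open>F\<close>, so
      \<open>F\<close> is monochromatic for \<open>X n\<close>; the weights being nonnegative, its
      row sum is part of the one already bounded.\<close>
    have "(\<Sum>k\<in>F-{j}. w j k) = (\<Sum>k\<in>F-{j}. if X n k = X n j then w j k else 0)"
      using XF by (intro sum.cong refl) auto
    also have "\<dots> \<le> (\<Sum>k\<in>I \<inter> {..<n}-{j}. if X n k = X n j then w j k else 0)"
      using F Fn by (intro sum_mono2) (auto simp: nonneg)
    also have "\<dots> \<le> B / real m" using F Fn by (intro X) auto
    finally show "(\<Sum>k\<in>F-{j}. w j k) \<le> B / real m" .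
  qed
qed

section \<open>Exponential sums on an interval\<close>

lemma L2_space_integrable_mult:
  assumes f: "f \<in> L2_space M" and g: "g \<in> L2_space M"
  shows "integrable M (\<lambda>t. f t * cnj (g t))"
proof (rule Bochner_Integration.integrable_bound)
  show "integrable M (\<lambda>t. (cmod (f t))\<^sup>2 + (cmod (g t))\<^sup>2)"
    using f g by (simp add: L2_space_def)
  have [measurable]: "f \<in> borel_measurable M" "g \<in> borel_measurable M"
    using f g by (simp_all add: L2_space_def)
  have [measurable]: "cnj \<in> borel_measurable borel"
    by (intro borel_measurable_continuous_onI continuous_intros)
  show "(\<lambda>t. f t * cnj (g t)) \<in> borel_measurable M" by measurable
  show "AE t in M. norm (f t * cnj (g t)) \<le> norm ((cmod (f t))\<^sup>2 + (cmod (g t))\<^sup>2)"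
  proof (intro always_eventually allI)
    fix t
    have "2 * (cmod (f t) * cmod (g t)) \<le> (cmod (f t))\<^sup>2 + (cmod (g t))\<^sup>2"
      using sum_squares_bound[of "cmod (f t)" "cmod (g t)"] by simp
    moreover have "0 \<le> cmod (f t) * cmod (g t)" by simp
    ultimately show "norm (f t * cnj (g t)) \<le> norm ((cmod (f t))\<^sup>2 + (cmod (g t))\<^sup>2)"
      unfolding norm_mult complex_mod_cnj real_norm_def by linarith
  qed
qed

lemma L2_space_add:
  assumes f: "f \<in> L2_space M" and g: "g \<in> L2_space M"
  shows "(\<lambda>t. f t + g t) \<in> L2_space M"
proof -
  have [measurable]: "f \<in> borel_measurable M" "g \<in> borel_measurable M"
    using f g by (simp_all add: L2_space_def)
  have "integrable M (\<lambda>t. 2 * (cmod (f t))\<^sup>2 + 2 * (cmod (g t))\<^sup>2)"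
    using f g by (simp add: L2_space_def)
  then have "integrable M (\<lambda>t. (cmod (f t + g t))\<^sup>2)"
  proof (rule Bochner_Integration.integrable_bound)
    show "AE t in M. norm ((cmod (f t + g t))\<^sup>2) \<le> norm (2 * (cmod (f t))\<^sup>2 + 2 * (cmod (g t))\<^sup>2)"
    proof (intro always_eventually allI)
      fix t
      have "(cmod (f t + g t))\<^sup>2 \<le> (cmod (f t) + cmod (g t))\<^sup>2"
        by (intro power_mono norm_triangle_ineq) auto
      also have "\<dots> \<le> 2 * (cmod (f t))\<^sup>2 + 2 * (cmod (g t))\<^sup>2"
        using sum_squares_bound[of "cmod (f t)" "cmod (g t)"] by (simp add: power2_sum)
      finally show "norm ((cmod (f t + g t))\<^sup>2) \<le> norm (2 * (cmod (f t))\<^sup>2 + 2 * (cmod (g t))\<^sup>2)"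
        by simp
    qed
  qed measurable
  then show ?thesis by (simp add: L2_space_def)
qed

lemma L2_space_scale: "f \<in> L2_space M \<Longrightarrow> (\<lambda>t. c * f t) \<in> L2_space M"
  by (auto simp: L2_space_def norm_mult power_mult_distrib)

lemma L2_space_sum:
  assumes "\<And>n. n \<in> F \<Longrightarrow> h n \<in> L2_space M"
  shows "(\<lambda>t. \<Sum>n\<in>F. c n * h n t) \<in> L2_space M"
  using assms
proof (induction F rule: infinite_finite_induct)
  case (insert n F)
  then show ?case
    using L2_space_add[OF L2_space_scale[of "h n" M "c n"], of "\<lambda>t. \<Sum>n\<in>F. c n * h n t"] by simp
qed (simp_all add: L2_space_def)

lemma L2_norm_power2: "complex_of_real ((L2_norm M f)\<^sup>2) = L2_inner M f f"
proof -
  have "(L2_norm M f)\<^sup>2 = (LINT t|M. (cmod (f t))\<^sup>2)"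
    by (simp add: L2_norm_def)
  then show ?thesis
    by (simp add: L2_inner_def complex_norm_square[symmetric] flip: integral_complex_of_real)
qed

text \<open>The synthesis operator is the adjoint of the analysis operator and has the same norm.
  Concretely, expand the squared norm \<open>X\<close> of the sum against its own coefficients;
  Cauchy-Schwarz and the Bessel bound give \<open>X\<^sup>2 \<le> S * (C * X)\<close>.\<close>

lemma Bessel_sequence_synthesis:
  assumes "Bessel_sequence M h"
  obtains C where "C > 0"
    and "\<And>F c. finite F \<Longrightarrow> (L2_norm M (\<lambda>t. \<Sum>n\<in>F. c n * h n t))\<^sup>2 \<le> C * (\<Sum>n\<in>F. (cmod (c n))\<^sup>2)"
proof -
  obtain C where C: "C > 0" and L2: "\<And>n. h n \<in> L2_space M"
    and bessel: "\<And>f. f \<in> L2_space M \<Longrightarrow> summable (\<lambda>n. (cmod (L2_inner M f (h n)))\<^sup>2) \<and>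
        (\<Sum>n. (cmod (L2_inner M f (h n)))\<^sup>2) \<le> C * (L2_norm M f)\<^sup>2"
    using assms by (auto simp: Bessel_sequence_def)
  show ?thesis
  proof (rule that[OF C])
    fix F :: "nat set" and c :: "nat \<Rightarrow> complex"
    assume F: "finite F"
    define f where "f t = (\<Sum>n\<in>F. c n * h n t)" for t
    define X where "X = (L2_norm M f)\<^sup>2"
    define S where "S = (\<Sum>n\<in>F. (cmod (c n))\<^sup>2)"
    have X0: "X \<ge> 0" by (simp add: X_def)
    have f: "f \<in> L2_space M" unfolding f_def[abs_def] by (intro L2_space_sum L2)
    have "L2_inner M f f = (LINT t|M. (\<Sum>n\<in>F. cnj (c n) * (f t * cnj (h n t))))"
      unfolding L2_inner_def
    proof (rule Bochner_Integration.integral_cong[OF refl])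
      fix t
      have "cnj (f t) = (\<Sum>n\<in>F. cnj (c n) * cnj (h n t))" by (simp add: f_def)
      then show "f t * cnj (f t) = (\<Sum>n\<in>F. cnj (c n) * (f t * cnj (h n t)))"
        by (simp add: sum_distrib_left mult_ac)
    qed
    also have "\<dots> = (\<Sum>n\<in>F. cnj (c n) * L2_inner M f (h n))"
      unfolding L2_inner_def
      by (subst Bochner_Integration.integral_sum)
        (intro integrable_mult_right L2_space_integrable_mult f L2, simp)
    finally have "complex_of_real X = (\<Sum>n\<in>F. cnj (c n) * L2_inner M f (h n))"
      by (simp add: X_def L2_norm_power2 del: of_real_power)
    then have "X = cmod (\<Sum>n\<in>F. cnj (c n) * L2_inner M f (h n))"
      using X0 by (metis norm_of_real abs_of_nonneg)
    also have "\<dots> \<le> (\<Sum>n\<in>F. cmod (c n) * cmod (L2_inner M f (h n)))"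
      by (rule sum_norm_le) (simp add: norm_mult)
    finally have "X\<^sup>2 \<le> (\<Sum>n\<in>F. cmod (c n) * cmod (L2_inner M f (h n)))\<^sup>2"
      using X0 by (intro power_mono)
    also have "\<dots> \<le> S * (\<Sum>n\<in>F. (cmod (L2_inner M f (h n)))\<^sup>2)"
      unfolding S_def by (rule Cauchy_Schwarz_ineq_sum)
    also have "\<dots> \<le> S * (C * X)"
    proof (rule mult_left_mono)
      have "(\<Sum>n\<in>F. (cmod (L2_inner M f (h n)))\<^sup>2) \<le> (\<Sum>n. (cmod (L2_inner M f (h n)))\<^sup>2)"
        using bessel[OF f] F by (intro sum_le_suminf) auto
      then show "(\<Sum>n\<in>F. (cmod (L2_inner M f (h n)))\<^sup>2) \<le> C * X"
        using bessel[OF f] by (simp add: X_def)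
    qed (simp add: S_def sum_nonneg)
    finally have "X * X \<le> C * S * X" by (simp add: power2_eq_square mult_ac)
    moreover have "0 \<le> C * S" using C by (simp add: S_def sum_nonneg)
    ultimately have "X \<le> C * S" using X0 by (cases "X = 0") auto
    then show "(L2_norm M (\<lambda>t. \<Sum>n\<in>F. c n * h n t))\<^sup>2 \<le> C * (\<Sum>n\<in>F. (cmod (c n))\<^sup>2)"
      by (simp add: X_def S_def f_def[abs_def])
  qed
qed

lemma L2_norm_continuous:
  fixes f :: "real \<Rightarrow> complex"
  assumes f: "continuous_on UNIV f"
  shows "(L2_norm (lebesgue_on {-a<..<a}) f)\<^sup>2 = integral {-a..a} (\<lambda>t. (cmod (f t))\<^sup>2)"
proof -
  have "continuous_on {-a..a} (\<lambda>t. (cmod (f t))\<^sup>2)"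
    using f by (intro continuous_intros) (auto intro: continuous_on_subset)
  then have "integrable (lebesgue_on {-a..a}) (\<lambda>t. (cmod (f t))\<^sup>2)"
    by (rule continuous_imp_integrable_real)
  then have "set_integrable lebesgue {-a..a} (\<lambda>t. (cmod (f t))\<^sup>2)"
    by (simp add: set_integrable_def integrable_restrict_space)
  then have "set_integrable lebesgue {-a<..<a} (\<lambda>t. (cmod (f t))\<^sup>2)"
    by (rule set_integrable_subset) auto
  then have "integrable (lebesgue_on {-a<..<a}) (\<lambda>t. (cmod (f t))\<^sup>2)"
    by (simp add: set_integrable_def integrable_restrict_space)
  then have "(LINT t|lebesgue_on {-a<..<a}. (cmod (f t))\<^sup>2) = integral {-a..a} (\<lambda>t. (cmod (f t))\<^sup>2)"
    by (simp add: lebesgue_integral_eq_integral integral_open_interval_real)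
  moreover have "0 \<le> (LINT t|lebesgue_on {-a<..<a}. (cmod (f t))\<^sup>2)" by simp
  ultimately show ?thesis by (simp add: L2_norm_def)
qed

section \<open>Energies of exponential sums\<close>

definition exp_sum :: "(nat \<Rightarrow> complex) \<Rightarrow> nat set \<Rightarrow> (nat \<Rightarrow> complex) \<Rightarrow> real \<Rightarrow> complex" where
  "exp_sum \<mu> F c t = (\<Sum>n\<in>F. c n * exponential (\<mu> n) t)"

text \<open>For continuous functions this is the squared norm of L^2(-a,a), written as a gauge
  integral over the closed interval so that the fundamental theorem of calculus applies.\<close>

definition energy :: "real \<Rightarrow> (real \<Rightarrow> complex) \<Rightarrow> real" where
  "energy a f = integral {-a..a} (\<lambda>t. (cmod (f t))\<^sup>2)"

lemma continuous_on_exponential: "continuous_on A (exponential \<mu>)"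
  unfolding exponential_def[abs_def] by (intro continuous_intros)

lemma continuous_on_exp_sum: "continuous_on A (exp_sum \<mu> F c)"
  unfolding exp_sum_def[abs_def] by (intro continuous_intros continuous_on_exponential)

lemma cmod_exponential: "cmod (exponential \<mu> t) = exp (- (Im \<mu> * t))"
  by (simp add: exponential_def)

lemma energy_integrable: "continuous_on UNIV f \<Longrightarrow> (\<lambda>t. (cmod (f t))\<^sup>2) integrable_on {-a..a}"
  for f :: "real \<Rightarrow> complex"
  by (intro integrable_continuous_real continuous_intros) (auto intro: continuous_on_subset)

lemma energy_nonneg: "energy a f \<ge> 0"
  unfolding energy_def
  by (cases "(\<lambda>t. (cmod (f t))\<^sup>2) integrable_on {-a..a}")
    (auto intro: Henstock_Kurzweil_Integration.integral_nonneg simp: not_integrable_integral)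

lemma has_integral_exp_imaginary:
  assumes "a \<ge> 0" "w \<noteq> 0"
  shows "((\<lambda>t::real. exp (\<i> * w * of_real t)) has_integral
           \<i> / w * (exp (- \<i> * w * of_real a) - exp (\<i> * w * of_real a))) {-a..a}"
proof -
  have "((\<lambda>t::real. exp (\<i> * w * of_real t)) has_integral
     (- \<i> / w * exp (\<i> * w * of_real a)) - (- \<i> / w * exp (\<i> * w * of_real (-a)))) {-a..a}"
  proof (rule fundamental_theorem_of_calculus)
    fix t :: real
    have "((\<lambda>z. - \<i> / w * exp (\<i> * w * z)) has_field_derivative exp (\<i> * w * of_real t)) (at (of_real t))"
      using assms(2) by (auto intro!: derivative_eq_intros)
    then show "((\<lambda>t. - \<i> / w * exp (\<i> * w * of_real t)) has_vector_derivative exp (\<i> * w * of_real t))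
        (at t within {-a..a})"
      by (auto dest: has_vector_derivative_real_field intro: has_vector_derivative_at_within simp: o_def)
  qed (use assms in simp)
  then show ?thesis by (simp add: algebra_simps)
qed

text \<open>Expanding \<open>1 / w * (exp (-iaw) - exp (iaw))\<close> expresses the Gram matrix on the interval through
  the Gram matrix on the half-line: the second form is the mass lost beyond the right endpoint.\<close>

lemma energy_exp_sum:
  fixes \<mu> b :: "nat \<Rightarrow> complex"
  assumes a: "a \<ge> 0" and F: "finite F" and pos: "\<And>n. n \<in> F \<Longrightarrow> Im (\<mu> n) > 0"
  defines "K \<equiv> \<lambda>j k. hardy_kernel (\<mu> j) (\<mu> k)" and "E \<equiv> \<lambda>n. exp (2 * \<i> * of_real a * \<mu> n)"
  shows "energy a (exp_sum \<mu> F (\<lambda>n. b n * of_real (sqrt (2 * Im (\<mu> n))) * exp (\<i> * of_real a * \<mu> n)))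
     = Re (hform K F b b) - Re (hform K F (\<lambda>n. b n * E n) (\<lambda>n. b n * E n))"
proof -
  \<comment> \<open>The square root normalises the exponential on the half-line, and
    \<open>exp (\<i> * of_real a * \<mu> n)\<close> translates the interval to (0, 2a). A further
    translation by 2a multiplies the coefficients by \<open>E\<close>.\<close>
  define c where "c n = b n * of_real (sqrt (2 * Im (\<mu> n))) * exp (\<i> * of_real a * \<mu> n)" for n
  define w where "w j k = \<mu> j - cnj (\<mu> k)" for j k
  define I where "I j k = \<i> / w j k * (exp (- \<i> * w j k * of_real a) - exp (\<i> * w j k * of_real a))" for j k
  have w0: "w j k \<noteq> 0" if "j \<in> F" "k \<in> F" for j k
    using upper_half_plane_neq_cnj[OF pos pos] that by (simp add: w_def)
  have "((\<lambda>t. \<Sum>j\<in>F. \<Sum>k\<in>F. c j * cnj (c k) * exp (\<i> * w j k * of_real t)) has_integral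
     (\<Sum>j\<in>F. \<Sum>k\<in>F. c j * cnj (c k) * I j k)) {-a..a}"
    unfolding I_def using F a w0
    by (intro has_integral_sum has_integral_mult_right has_integral_exp_imaginary) auto
  from has_integral_linear[OF this bounded_linear_Re]
  have "((\<lambda>t. Re (\<Sum>j\<in>F. \<Sum>k\<in>F. c j * cnj (c k) * exp (\<i> * w j k * of_real t))) has_integral
     Re (\<Sum>j\<in>F. \<Sum>k\<in>F. c j * cnj (c k) * I j k)) {-a..a}"
    by (simp add: o_def)
  moreover have "Re (\<Sum>j\<in>F. \<Sum>k\<in>F. c j * cnj (c k) * exp (\<i> * w j k * of_real t))
     = (cmod (exp_sum \<mu> F c t))\<^sup>2" for t
  proof -
    have e: "exp (\<i> * w j k * of_real t) = exponential (\<mu> j) t * cnj (exponential (\<mu> k) t)" for j k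
      by (simp add: w_def exponential_def exp_cnj flip: exp_add) (simp add: algebra_simps)
    have "complex_of_real ((cmod (exp_sum \<mu> F c t))\<^sup>2) = exp_sum \<mu> F c t * cnj (exp_sum \<mu> F c t)"
      by (rule complex_norm_square)
    also have "\<dots> = (\<Sum>j\<in>F. \<Sum>k\<in>F. c j * cnj (c k) * exp (\<i> * w j k * of_real t))"
      unfolding exp_sum_def e cnj_sum sum_product by (simp add: mult_ac)
    finally show ?thesis by (metis Re_complex_of_real)
  qed
  ultimately have "((\<lambda>t. (cmod (exp_sum \<mu> F c t))\<^sup>2) has_integral
     Re (\<Sum>j\<in>F. \<Sum>k\<in>F. c j * cnj (c k) * I j k)) {-a..a}"
    by simp
  then have "energy a (exp_sum \<mu> F c) = Re (\<Sum>j\<in>F. \<Sum>k\<in>F. c j * cnj (c k) * I j k)"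
    unfolding energy_def by (rule integral_unique)
  also have "(\<Sum>j\<in>F. \<Sum>k\<in>F. c j * cnj (c k) * I j k)
     = hform K F b b - hform K F (\<lambda>n. b n * E n) (\<lambda>n. b n * E n)"
    unfolding hform_def sum_subtractf[symmetric]
  proof (intro sum.cong refl)
    fix j k assume jk: "j \<in> F" "k \<in> F"
    define s where "s = complex_of_real (sqrt (Im (\<mu> j) * Im (\<mu> k)))"
    have s: "complex_of_real (sqrt (2 * Im (\<mu> j))) * complex_of_real (sqrt (2 * Im (\<mu> k))) = 2 * s"
    proof -
      have "sqrt (2 * Im (\<mu> j)) * sqrt (2 * Im (\<mu> k)) = 2 * sqrt (Im (\<mu> j) * Im (\<mu> k))"
        by (simp add: real_sqrt_mult)
      then show ?thesis
        unfolding s_def of_real_mult[symmetric] by simp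
    qed
    have K: "K j k = 2 * \<i> * s / w j k" by (simp add: K_def hardy_kernel_def s_def w_def)
    have e1: "exp (\<i> * of_real a * \<mu> j) * cnj (exp (\<i> * of_real a * \<mu> k)) = exp (\<i> * w j k * of_real a)"
      by (simp add: w_def exp_cnj flip: exp_add) (simp add: algebra_simps)
    have e2: "E j * cnj (E k) = exp (\<i> * w j k * of_real a) * exp (\<i> * w j k * of_real a)"
      by (simp add: E_def w_def exp_cnj flip: exp_add) (simp add: algebra_simps)
    have e3: "exp (\<i> * w j k * of_real a) * exp (- \<i> * w j k * of_real a) = 1"
      by (simp flip: exp_add)
    define P where "P = exp (\<i> * w j k * of_real a)"
    have "c j * cnj (c k) = b j * cnj (b k) * (2 * s) * P"
      unfolding c_def P_def s[symmetric] e1[symmetric] by (simp add: mult_ac)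
    then have "c j * cnj (c k) * I j k
      = b j * cnj (b k) * (2 * s) * (\<i> / w j k) * (P * exp (- \<i> * w j k * of_real a) - P * P)"
      by (simp add: I_def P_def algebra_simps)
    also have "\<dots> = b j * cnj (b k) * K j k * (1 - E j * cnj (E k))"
      unfolding K e2 P_def e3 by (simp add: mult_ac)
    finally show "c j * cnj (c k) * I j k
      = b j * cnj (b k) * K j k - b j * E j * cnj (b k * E k) * K j k"
      by (simp add: algebra_simps)
  qed
  finally show ?thesis by (simp add: c_def[abs_def])
qed

text \<open>The shift multiplies the sum by \<open>exp (- H * t)\<close>, whose square is at most
  \<open>exp (2 * a * H)\<close> on the interval.\<close>

lemma energy_exp_sum_shift:
  assumes "H \<ge> 0"
  shows "energy a (exp_sum (\<lambda>n. \<mu> n + \<i> * of_real H) F c) \<le> exp (2 * a * H) * energy a (exp_sum \<mu> F c)"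
proof -
  have "exp_sum (\<lambda>n. \<mu> n + \<i> * of_real H) F c t = exp (- of_real (H * t)) * exp_sum \<mu> F c t" for t
  proof -
    have "\<i> * (\<mu> n + \<i> * of_real H) * of_real t = - of_real (H * t) + \<i> * \<mu> n * of_real t" for n
      by (simp add: algebra_simps)
    then show ?thesis
      unfolding exp_sum_def exponential_def sum_distrib_left by (simp only: exp_add mult_ac)
  qed
  then have sq: "(cmod (exp_sum (\<lambda>n. \<mu> n + \<i> * of_real H) F c t))\<^sup>2
      = exp (- 2 * (H * t)) * (cmod (exp_sum \<mu> F c t))\<^sup>2" for t
    by (simp add: norm_mult power_mult_distrib exp_double[symmetric])
  have "energy a (exp_sum (\<lambda>n. \<mu> n + \<i> * of_real H) F c)
      \<le> integral {-a..a} (\<lambda>t. exp (2 * a * H) * (cmod (exp_sum \<mu> F c t))\<^sup>2)"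
    unfolding energy_def
  proof (rule integral_le)
    show "(\<lambda>t. exp (2 * a * H) * (cmod (exp_sum \<mu> F c t))\<^sup>2) integrable_on {-a..a}"
      by (intro integrable_on_mult_right energy_integrable continuous_on_exp_sum)
    fix t assume "t \<in> {-a..a}"
    then have "- (t * H) \<le> a * H" using assms mult_right_mono[of "- t" a H] by simp
    then show "(cmod (exp_sum (\<lambda>n. \<mu> n + \<i> * of_real H) F c t))\<^sup>2 \<le> exp (2 * a * H) * (cmod (exp_sum \<mu> F c t))\<^sup>2"
      unfolding sq by (intro mult_right_mono) (auto simp: mult_ac)
  qed (intro energy_integrable continuous_on_exp_sum)
  then show ?thesis by (simp add: energy_def)
qed

lemma energy_exp_sum_reflect: "energy a (exp_sum (\<lambda>n. - \<mu> n) F c) = energy a (exp_sum \<mu> F c)"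
proof -
  have "energy a (exp_sum \<mu> F c) = integral {-a..-(-a)} (\<lambda>t. (cmod (exp_sum \<mu> F c (- t)))\<^sup>2)"
    unfolding energy_def by (subst Henstock_Kurzweil_Integration.integral_reflect_real) simp
  then show ?thesis by (simp add: energy_def exp_sum_def exponential_def)
qed

lemma energy_exponential_reflect: "energy a (exponential (- \<mu>)) = energy a (exponential \<mu>)"
  using energy_exp_sum_reflect[of a "\<lambda>_. \<mu>" "{0}" "\<lambda>_. 1"] by (simp add: exp_sum_def[abs_def])

lemma energy_exponential_pos:
  assumes "a > 0"
  shows "energy a (exponential \<mu>) > 0"
proof -
  have "integral {-a..a} (\<lambda>t. exp (- 2 * \<bar>Im \<mu>\<bar> * a)) \<le> energy a (exponential \<mu>)"
    unfolding energy_def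
  proof (rule integral_le)
    fix t assume "t \<in> {-a..a}"
    then have "\<bar>Im \<mu> * t\<bar> \<le> \<bar>Im \<mu>\<bar> * a" by (auto simp: abs_mult intro!: mult_left_mono)
    then have "- (\<bar>Im \<mu>\<bar> * a) \<le> - (Im \<mu> * t)" by linarith
    then show "exp (- 2 * \<bar>Im \<mu>\<bar> * a) \<le> (cmod (exponential \<mu> t))\<^sup>2"
      by (simp add: cmod_exponential exp_double[symmetric])
  qed (auto intro: energy_integrable continuous_on_exponential)
  moreover have "integral {-a..a} (\<lambda>t. exp (- 2 * \<bar>Im \<mu>\<bar> * a)) > 0"
    using assms by simp
  ultimately show ?thesis by linarith
qed

text \<open>Exact integration controls the part with \<open>Im \<mu>\<close>, and the crude bound
  \<open>2 * a * exp (2 * a * Im \<mu>)\<close> for the energy controls the part with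
  \<open>H\<close>. The estimate stays uniform as \<open>Im \<mu>\<close> tends to 0, where
  half-line normalisation alone degenerates.\<close>

lemma energy_exponential_le:
  assumes a: "a > 0" and y: "Im \<mu> \<ge> 0" and H: "H \<ge> 0"
  shows "energy a (exponential \<mu>) * (2 * (Im \<mu> + H)) \<le> (1 + 4 * a * H) * exp (2 * a * Im \<mu>)"
proof -
  define y where "y = Im \<mu>"
  have sq: "(cmod (exponential \<mu> t))\<^sup>2 = exp (- 2 * y * t)" for t
    by (simp add: cmod_exponential exp_double[symmetric] y_def)
  have 1: "energy a (exponential \<mu>) \<le> 2 * a * exp (2 * a * y)"
  proof -
    have "energy a (exponential \<mu>) \<le> integral {-a..a} (\<lambda>t. exp (2 * a * y))"
      unfolding energy_def
    proof (rule integral_le)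
      fix t assume "t \<in> {-a..a}"
      then have "y * (- t) \<le> y * a" using y by (intro mult_left_mono) (auto simp: y_def)
      then show "(cmod (exponential \<mu> t))\<^sup>2 \<le> exp (2 * a * y)" by (simp add: sq mult_ac)
    qed (auto intro: energy_integrable continuous_on_exponential)
    then show ?thesis using a by simp
  qed
  have "((\<lambda>t. 2 * y * exp (- 2 * y * t)) has_integral (- exp (- 2 * y * a)) - (- exp (- 2 * y * (- a)))) {-a..a}"
    by (rule fundamental_theorem_of_calculus)
      (use a in \<open>auto intro!: derivative_eq_intros simp flip: has_real_derivative_iff_has_vector_derivative\<close>)
  from integral_unique[OF this]
  have "integral {-a..a} (\<lambda>t. 2 * y * exp (- 2 * y * t)) = exp (2 * a * y) - exp (- (2 * y * a))"
    by (simp add: mult_ac)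
  moreover have "integral {-a..a} (\<lambda>t. 2 * y * exp (- 2 * y * t)) = 2 * y * energy a (exponential \<mu>)"
    unfolding energy_def sq by (rule integral_mult_right)
  ultimately have "2 * y * energy a (exponential \<mu>) = exp (2 * a * y) - exp (- (2 * y * a))" by simp
  then have 2: "2 * y * energy a (exponential \<mu>) \<le> exp (2 * a * y)" by simp
  have "2 * H * energy a (exponential \<mu>) \<le> 2 * H * (2 * a * exp (2 * a * y))"
    using 1 H by (intro mult_left_mono) auto
  with 2 show ?thesis by (simp add: y_def algebra_simps)
qed

section \<open>Splitting into Riesz basic sequences\<close>

text \<open>Exponential decay beats a quadratic polynomial. With the \<open>B\<close> and
  \<open>q\<close> of the next proof the last condition is \<open>4 * B\<^sup>2 * q < 1\<close>, so
  the error \<open>B * q\<close> is at most half of the lower bound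
  \<open>1 / (2 * B)\<close>.\<close>

lemma exists_large_shift:
  fixes a C :: real
  assumes "a > 0" "C > 0"
  obtains H where "H > 0" "exp (- 4 * a * H) < 1"
    "4 * (C * (1 + 4 * a * H) / (1 - exp (- 4 * a * H)))\<^sup>2 * exp (- 4 * a * H) < 1"
proof -
  have "((\<lambda>H. 4 * (C * (1 + 4 * a * H) / (1 - exp (- 4 * a * H)))\<^sup>2 * exp (- 4 * a * H)) \<longlongrightarrow> 0) at_top"
    using assms by real_asymp
  then have "eventually (\<lambda>H. 4 * (C * (1 + 4 * a * H) / (1 - exp (- 4 * a * H)))\<^sup>2 * exp (- 4 * a * H) < 1) at_top"
    by (rule order_tendstoD) simp
  moreover have "eventually (\<lambda>H::real. H > 0) at_top" by (rule eventually_gt_at_top)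
  ultimately obtain H where "H > 0"
    "4 * (C * (1 + 4 * a * H) / (1 - exp (- 4 * a * H)))\<^sup>2 * exp (- 4 * a * H) < 1"
    using eventually_happens[OF eventually_conj] by (metis (no_types, lifting) trivial_limit_at_top_linorder)
  then show ?thesis using assms by (intro that) auto
qed

text \<open>Multiplication by \<open>exp (- H t)\<close> moves the frequencies to height at least \<open>H\<close>. The Bessel
  constant of the shifted system grows only linearly in \<open>H\<close>, while the discrepancy between the
  interval and the half-line decays like \<open>exp (- 4 a H)\<close>.\<close>

lemma upper_half_plane_lower_bounds:
  fixes lam :: "nat \<Rightarrow> complex"
  assumes a: "a > 0" and C: "C > 0" and I: "\<And>n. n \<in> I \<Longrightarrow> Im (lam n) \<ge> 0"
    and synthesis: "\<And>F c. finite F \<Longrightarrow> F \<subseteq> I \<Longrightarrow>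
      energy a (exp_sum lam F c) \<le> C * (\<Sum>n\<in>F. energy a (exponential (lam n)) * (cmod (c n))\<^sup>2)"
  obtains m :: nat and col :: "nat \<Rightarrow> nat" and \<kappa> :: real
  where "\<And>n. col n < m" "\<kappa> > 0"
    "\<And>F c. finite F \<Longrightarrow> F \<subseteq> I \<Longrightarrow> (\<And>j k. j \<in> F \<Longrightarrow> k \<in> F \<Longrightarrow> col j = col k) \<Longrightarrow>
      \<kappa> * (\<Sum>n\<in>F. energy a (exponential (lam n)) * (cmod (c n))\<^sup>2) \<le> energy a (exp_sum lam F c)"
proof -
  obtain H where H: "H > 0" and q1: "exp (- 4 * a * H) < 1"
    and small: "4 * (C * (1 + 4 * a * H) / (1 - exp (- 4 * a * H)))\<^sup>2 * exp (- 4 * a * H) < 1"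
    using exists_large_shift[OF a C] by blast
  define q where "q = exp (- 4 * a * H)"
  define C1 where "C1 = C * (1 + 4 * a * H)"
  define B where "B = C1 / (1 - q)"
  define \<mu> where "\<mu> n = lam n + \<i> * of_real H" for n
  define K where "K j k = hardy_kernel (\<mu> j) (\<mu> k)" for j k
  define E where "E n = exp (2 * \<i> * of_real a * \<mu> n)" for n
  define N where "N n = energy a (exponential (lam n))" for n
  define coef :: "(nat \<Rightarrow> complex) \<Rightarrow> nat \<Rightarrow> complex" where
    "coef b n = b n * of_real (sqrt (2 * Im (\<mu> n))) * exp (\<i> * of_real a * \<mu> n)" for b n
  have q: "0 \<le> q" "q < 1" using q1 by (simp_all add: q_def)
  have aH: "0 < a * H" using a H by simp
  have C1: "C1 > 0" using C aH by (simp add: C1_def add_pos_pos)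
  have B: "B > 0" using C1 q by (simp add: B_def)
  have Bq: "B * q \<le> 1 / (4 * B)"
  proof -
    have "4 * B\<^sup>2 * q < 1" using small by (simp add: B_def C1_def q_def)
    then show ?thesis using B by (simp add: field_simps power2_eq_square)
  qed
  have Im_mu: "Im (\<mu> n) = Im (lam n) + H" for n by (simp add: \<mu>_def)
  have pos: "Im (\<mu> n) > 0" if "n \<in> I" for n using I[OF that] H by (simp add: Im_mu)
  have herm: "cnj (K j k) = K k j" for j k by (simp add: K_def hardy_kernel_cnj)
  have E_le: "(cmod (E n))\<^sup>2 \<le> q" if "n \<in> I" for n
  proof -
    have "0 \<le> a * Im (lam n)" using a I[OF that] by simp
    then have "- (4 * (a * Im (\<mu> n))) \<le> - (4 * (a * H))" by (simp add: Im_mu algebra_simps)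
    then show ?thesis by (simp add: E_def q_def exp_double[symmetric] mult_ac)
  qed
  \<comment> \<open>Compares the normalisation of the original exponentials on the interval with
    that of the shifted ones on the half-line. The gain \<open>exp (- 2 * a * H)\<close> will cancel
    the loss in \<open>shift\<close>, which leaves \<open>C1\<close> linear in
    \<open>H\<close>.\<close>
  have coef_le: "N n * (cmod (coef b n))\<^sup>2 \<le> (1 + 4 * a * H) * exp (- 2 * a * H) * (cmod (b n))\<^sup>2"
    if n: "n \<in> I" for n b
  proof -
    have "(cmod (coef b n))\<^sup>2 = (cmod (b n))\<^sup>2 * (2 * Im (\<mu> n)) * exp (- 2 * a * Im (\<mu> n))"
      using pos[OF n] by (simp add: coef_def norm_mult power_mult_distrib exp_double[symmetric] mult_ac)
    then have "N n * (cmod (coef b n))\<^sup>2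
        = (N n * (2 * (Im (lam n) + H))) * (exp (- 2 * a * Im (\<mu> n)) * (cmod (b n))\<^sup>2)"
      by (simp add: Im_mu)
    also have "\<dots> \<le> ((1 + 4 * a * H) * exp (2 * a * Im (lam n))) * (exp (- 2 * a * Im (\<mu> n)) * (cmod (b n))\<^sup>2)"
      using energy_exponential_le[OF a I[OF n], of H] H
      by (intro mult_right_mono) (auto simp: N_def)
    also have "\<dots> = (1 + 4 * a * H) * (exp (2 * a * Im (lam n)) * exp (- 2 * a * Im (\<mu> n))) * (cmod (b n))\<^sup>2"
      by (simp only: mult_ac)
    also have "exp (2 * a * Im (lam n)) * exp (- 2 * a * Im (\<mu> n)) = exp (- 2 * a * H)"
      unfolding exp_add[symmetric] by (simp add: Im_mu algebra_simps)
    finally show ?thesis .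
  qed
  have sum_coef_le: "(\<Sum>n\<in>F. N n * (cmod (coef b n))\<^sup>2)
      \<le> (1 + 4 * a * H) * exp (- 2 * a * H) * (\<Sum>n\<in>F. (cmod (b n))\<^sup>2)" if "F \<subseteq> I" for F b
    unfolding sum_distrib_left using that by (intro sum_mono coef_le) auto
  have energy_coef: "energy a (exp_sum \<mu> F (coef b))
      = Re (hform K F b b) - Re (hform K F (\<lambda>n. b n * E n) (\<lambda>n. b n * E n))"
    if "finite F" "F \<subseteq> I" for F b
    unfolding coef_def[abs_def] K_def[abs_def] E_def[abs_def]
    by (intro energy_exp_sum) (use a that pos in auto)
  have shift: "energy a (exp_sum \<mu> F c) \<le> exp (2 * a * H) * energy a (exp_sum lam F c)" for F c
    using energy_exp_sum_shift[of H a lam F c] H by (simp add: \<mu>_def[abs_def])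
  have upper: "energy a (exp_sum \<mu> F (coef b)) \<le> C1 * (\<Sum>n\<in>F. (cmod (b n))\<^sup>2)"
    if F: "finite F" "F \<subseteq> I" for F b
  proof -
    define S where "S = (\<Sum>n\<in>F. (cmod (b n))\<^sup>2)"
    have "energy a (exp_sum \<mu> F (coef b)) \<le> exp (2 * a * H) * energy a (exp_sum lam F (coef b))"
      by (rule shift)
    also have "\<dots> \<le> exp (2 * a * H) * (C * (\<Sum>n\<in>F. N n * (cmod (coef b n))\<^sup>2))"
      using synthesis[OF F] by (intro mult_left_mono) (auto simp: N_def)
    also have "\<dots> \<le> exp (2 * a * H) * (C * ((1 + 4 * a * H) * exp (- 2 * a * H) * S))"
      using sum_coef_le[OF F(2)] C unfolding S_def by (intro mult_left_mono) auto
    also have "\<dots> = (exp (2 * a * H) * exp (- 2 * a * H)) * C1 * S"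
      by (simp only: C1_def mult_ac)
    also have "exp (2 * a * H) * exp (- 2 * a * H) = 1" by (simp flip: exp_add)
    finally show ?thesis by (simp add: S_def)
  qed
  \<comment> \<open>Interval energies are the increments of the half-line form under multiplication
    by \<open>E\<close>, so their bounds sum to bounds for the form itself, with \<open>B\<close>
    the value of the geometric series.\<close>
  have form_bounds: "0 \<le> Re (hform K F b b)" "Re (hform K F b b) \<le> B * (\<Sum>n\<in>F. (cmod (b n))\<^sup>2)"
    if F: "finite F" "F \<subseteq> I" for F b
  proof -
    have low: "Re (hform K F (\<lambda>n. b n * E n) (\<lambda>n. b n * E n)) \<le> Re (hform K F b b)" for b
      using energy_coef[OF F, of b] energy_nonneg[of a "exp_sum \<mu> F (coef b)"] by linarith
    have up: "Re (hform K F b b) - Re (hform K F (\<lambda>n. b n * E n) (\<lambda>n. b n * E n))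
        \<le> C1 * (\<Sum>n\<in>F. (cmod (b n))\<^sup>2)" for b
      using energy_coef[OF F, of b] upper[OF F, of b] by linarith
    have EF: "(cmod (E n))\<^sup>2 \<le> q" if "n \<in> F" for n using E_le that F by auto
    show "0 \<le> Re (hform K F b b)"
      using hform_bounds_from_contraction(1)[OF F(1) q _ EF low up] C1 by simp
    show "Re (hform K F b b) \<le> B * (\<Sum>n\<in>F. (cmod (b n))\<^sup>2)"
      using hform_bounds_from_contraction(2)[OF F(1) q _ EF low up] C1 by (simp add: B_def)
  qed
  have row: "(\<Sum>k\<in>F-{j}. (cmod (K j k))\<^sup>2) \<le> B" if F: "finite F" "F \<subseteq> I" "j \<in> F" for F j
  proof -
    have "(\<Sum>k\<in>F-{j}. (cmod (K j k))\<^sup>2) \<le> (\<Sum>k\<in>F. (cmod (K j k))\<^sup>2)"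
      using F by (intro sum_mono2) auto
    also have "\<dots> \<le> B"
    proof (rule hform_row_bound[OF herm])
      show "K j j = 1" using hardy_kernel_self[OF pos] F by (auto simp: K_def)
    qed (use form_bounds[OF F(1,2)] B F in auto)
    finally show ?thesis .
  qed
  have sym: "(cmod (K j k))\<^sup>2 = (cmod (K k j))\<^sup>2" for j k
    using herm[of j k] by (metis complex_mod_cnj)
  \<comment> \<open>Enough colours to push the monochromatic row sums from \<open>B\<close> down to
    \<open>1/2\<close>.\<close>
  define m where "m = nat \<lceil>2 * B\<rceil>"
  have m: "real m \<ge> 2 * B" "m > 0" using B by (auto simp: m_def)
  have Bm: "B / real m \<le> 1/2" using m B by (simp add: field_simps)
  obtain col :: "nat \<Rightarrow> nat" where col: "\<And>n. col n < m"
    and mono: "\<And>F j. finite F \<Longrightarrow> F \<subseteq> I \<Longrightarrow> j \<in> F \<Longrightarrow> (\<And>k. k \<in> F \<Longrightarrow> col k = col j)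
      \<Longrightarrow> (\<Sum>k\<in>F-{j}. (cmod (K j k))\<^sup>2) \<le> B / real m"
  proof (rule balanced_colouring[of "\<lambda>j k. (cmod (K j k))\<^sup>2" m I B])
    show "(cmod (K j k))\<^sup>2 = (cmod (K k j))\<^sup>2" for j k by (rule sym)
  qed (use m row in auto)
  \<comment> \<open>The quotient of the two constants \<open>exp (- 2 * a * H) / (4 * B)\<close> and
    \<open>(1 + 4 * a * H) * exp (- 2 * a * H)\<close> that relate \<open>S\<close> to the energy
    and to the weighted coefficient sum.\<close>
  define \<kappa> where "\<kappa> = 1 / (4 * B * (1 + 4 * a * H))"
  show ?thesis
  proof (rule that[OF col])
    show "\<kappa> > 0" using B aH by (simp add: \<kappa>_def add_pos_pos)
    fix F c assume F: "finite F" "F \<subseteq> I" and same: "\<And>j k. j \<in> F \<Longrightarrow> k \<in> F \<Longrightarrow> col j = col k"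
    define b where "b n = c n / (of_real (sqrt (2 * Im (\<mu> n))) * exp (\<i> * of_real a * \<mu> n))" for n
    define S where "S = (\<Sum>n\<in>F. (cmod (b n))\<^sup>2)"
    have coef_b: "coef b n = c n" if "n \<in> F" for n
      using pos[of n] that F by (auto simp: coef_def b_def)
    have es: "exp_sum \<nu> F (coef b) = exp_sum \<nu> F c" for \<nu>
      unfolding exp_sum_def[abs_def] using coef_b by (intro ext sum.cong) auto
    have "S / (2 * B) \<le> Re (hform K F b b)"
      unfolding S_def K_def[abs_def]
    proof (rule hardy_form_lower_bound)
      show "(\<Sum>k\<in>F-{j}. (cmod (hardy_kernel (\<mu> j) (\<mu> k)))\<^sup>2) \<le> 1/2" if "j \<in> F" for j
        using order_trans[OF mono[OF F that same[OF _ that]] Bm] by (simp add: K_def)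
    qed (use F B pos form_bounds[OF F] in \<open>auto simp: K_def[abs_def]\<close>)
    moreover have "Re (hform K F (\<lambda>n. b n * E n) (\<lambda>n. b n * E n)) \<le> S / (4 * B)"
    proof -
      have "(\<Sum>n\<in>F. (cmod (b n * E n))\<^sup>2) \<le> (\<Sum>n\<in>F. q * (cmod (b n))\<^sup>2)"
      proof (rule sum_mono)
        fix n assume "n \<in> F"
        then have "(cmod (E n))\<^sup>2 * (cmod (b n))\<^sup>2 \<le> q * (cmod (b n))\<^sup>2"
          using E_le F by (intro mult_right_mono) auto
        then show "(cmod (b n * E n))\<^sup>2 \<le> q * (cmod (b n))\<^sup>2"
          by (simp add: norm_mult power_mult_distrib mult.commute)
      qed
      then have le: "(\<Sum>n\<in>F. (cmod (b n * E n))\<^sup>2) \<le> q * S"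
        by (simp add: S_def sum_distrib_left)
      have "Re (hform K F (\<lambda>n. b n * E n) (\<lambda>n. b n * E n)) \<le> B * (\<Sum>n\<in>F. (cmod (b n * E n))\<^sup>2)"
        by (rule form_bounds[OF F])
      also have "\<dots> \<le> B * (q * S)" using le B by (intro mult_left_mono) auto
      also have "\<dots> = (B * q) * S" by simp
      also have "\<dots> \<le> 1 / (4 * B) * S" using Bq by (intro mult_right_mono) (auto simp: S_def sum_nonneg)
      finally show ?thesis by simp
    qed
    moreover have "S / (2 * B) = S / (4 * B) + S / (4 * B)" using B by (simp add: field_simps)
    ultimately have "S / (4 * B) \<le> energy a (exp_sum \<mu> F c)"
      using energy_coef[OF F, of b] unfolding es by linarith
    also have "\<dots> \<le> exp (2 * a * H) * energy a (exp_sum lam F c)" by (rule shift)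
    finally have "exp (- 2 * a * H) * (S / (4 * B))
        \<le> exp (- 2 * a * H) * (exp (2 * a * H) * energy a (exp_sum lam F c))"
      by (intro mult_left_mono) auto
    also have "\<dots> = (exp (- 2 * a * H) * exp (2 * a * H)) * energy a (exp_sum lam F c)"
      by (simp only: mult.assoc)
    also have "exp (- 2 * a * H) * exp (2 * a * H) = 1" by (simp flip: exp_add)
    finally have low: "exp (- 2 * a * H) * (S / (4 * B)) \<le> energy a (exp_sum lam F c)" by simp
    have "(\<Sum>n\<in>F. N n * (cmod (c n))\<^sup>2) = (\<Sum>n\<in>F. N n * (cmod (coef b n))\<^sup>2)"
      using coef_b by (intro sum.cong) auto
    also have "\<dots> \<le> (1 + 4 * a * H) * exp (- 2 * a * H) * S"
      unfolding S_def by (rule sum_coef_le[OF F(2)])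
    finally have "\<kappa> * (\<Sum>n\<in>F. N n * (cmod (c n))\<^sup>2) \<le> \<kappa> * ((1 + 4 * a * H) * exp (- 2 * a * H) * S)"
      using \<open>\<kappa> > 0\<close> by (intro mult_left_mono) auto
    also have "\<dots> = exp (- 2 * a * H) * (S / (4 * B))"
    proof -
      have "1 + 4 * a * H \<noteq> 0" using aH by linarith
      then show ?thesis by (simp add: \<kappa>_def)
    qed
    also note low
    finally show "\<kappa> * (\<Sum>n\<in>F. energy a (exponential (lam n)) * (cmod (c n))\<^sup>2) \<le> energy a (exp_sum lam F c)"
      by (simp add: N_def)
  qed
qed

theorem corollary2p3:
  fixes a :: real and lam :: "nat \<Rightarrow> complex"
  assumes "a > 0"
    and "Bessel_sequence (lebesgue_on {-a<..<a})
           (\<lambda>n. L2_normalize (lebesgue_on {-a<..<a}) (exponential (lam n)))"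
  shows "splits_into_finitely_many_Riesz_basic (lebesgue_on {-a<..<a})
           (\<lambda>n. L2_normalize (lebesgue_on {-a<..<a}) (exponential (lam n)))"
proof -
  define M where "M = lebesgue_on {-a<..<a}"
  define h where "h n = L2_normalize M (exponential (lam n))" for n
  define N where "N n = energy a (exponential (lam n))" for n
  have N: "N n > 0" for n using energy_exponential_pos[OF assms(1)] by (simp add: N_def)
  have norm_sq: "(L2_norm M f)\<^sup>2 = energy a f" if "continuous_on UNIV f" for f
    using L2_norm_continuous[OF that] by (simp add: M_def energy_def)
  have "L2_norm M f \<ge> 0" for f by (simp add: L2_norm_def)
  then have norm_exp: "L2_norm M (exponential (lam n)) = sqrt (N n)" for n
    using norm_sq[OF continuous_on_exponential, of "lam n"] by (simp add: N_def real_sqrt_unique)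
  have sum_h: "(\<lambda>t. \<Sum>n\<in>F. c n * h n t) = exp_sum lam F (\<lambda>n. c n / of_real (sqrt (N n)))" for F c
    by (simp add: exp_sum_def[abs_def] h_def L2_normalize_def norm_exp)
  have norm_h: "(L2_norm M (\<lambda>t. \<Sum>n\<in>F. c n * h n t))\<^sup>2
      = energy a (exp_sum lam F (\<lambda>n. c n / of_real (sqrt (N n))))" for F c
    unfolding sum_h by (rule norm_sq[OF continuous_on_exp_sum])
  have bessel: "Bessel_sequence M h" using assms(2) by (simp add: M_def h_def[abs_def])
  then have L2: "h n \<in> L2_space M" for n by (simp add: Bessel_sequence_def)
  obtain C where C: "C > 0" and synthesis: "\<And>F c. finite F \<Longrightarrow>
      (L2_norm M (\<lambda>t. \<Sum>n\<in>F. c n * h n t))\<^sup>2 \<le> C * (\<Sum>n\<in>F. (cmod (c n))\<^sup>2)"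
    using Bessel_sequence_synthesis[OF bessel] by blast
  \<comment> \<open>Rescaling by \<open>sqrt (N n)\<close> passes from unit vectors to bare
    exponentials with weights \<open>N n\<close>, a form preserved by reflection.\<close>
  have syn: "energy a (exp_sum lam F c) \<le> C * (\<Sum>n\<in>F. N n * (cmod (c n))\<^sup>2)" if "finite F" for F c
  proof -
    have "sqrt (N n) \<noteq> 0" for n using N[of n] by simp
    then have "energy a (exp_sum lam F c) = (L2_norm M (\<lambda>t. \<Sum>n\<in>F. c n * of_real (sqrt (N n)) * h n t))\<^sup>2"
      unfolding norm_h by (simp add: exp_sum_def[abs_def])
    also have "\<dots> \<le> C * (\<Sum>n\<in>F. (cmod (c n * of_real (sqrt (N n))))\<^sup>2)" by (rule synthesis[OF that])
    also have "\<dots> = C * (\<Sum>n\<in>F. N n * (cmod (c n))\<^sup>2)"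
      using N by (simp add: norm_mult power_mult_distrib less_imp_le mult.commute)
    finally show ?thesis .
  qed
  define U where "U = {n. Im (lam n) \<ge> 0}"
  have upper_half: "Im (lam n) \<ge> 0" if "n \<in> U" for n using that by (simp add: U_def)
  have syn': "energy a (exp_sum lam F c) \<le> C * (\<Sum>n\<in>F. energy a (exponential (lam n)) * (cmod (c n))\<^sup>2)"
    if "finite F" "F \<subseteq> U" for F c
    using syn[OF that(1)] by (simp add: N_def)
  obtain m1 :: nat and col1 :: "nat \<Rightarrow> nat" and \<kappa>1 :: real where 1: "\<And>n. col1 n < m1" "\<kappa>1 > 0"
    "\<And>F c. finite F \<Longrightarrow> F \<subseteq> U \<Longrightarrow> (\<And>j k. j \<in> F \<Longrightarrow> k \<in> F \<Longrightarrow> col1 j = col1 k) \<Longrightarrow>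
      \<kappa>1 * (\<Sum>n\<in>F. N n * (cmod (c n))\<^sup>2) \<le> energy a (exp_sum lam F c)"
  proof (rule upper_half_plane_lower_bounds[where I = "U", OF assms(1) C upper_half syn', folded N_def])
    fix m :: nat and col :: "nat \<Rightarrow> nat" and \<kappa> :: real
    assume "\<And>n. col n < m" "\<kappa> > 0"
      "\<And>F c. finite F \<Longrightarrow> F \<subseteq> U \<Longrightarrow> (\<And>j k. j \<in> F \<Longrightarrow> k \<in> F \<Longrightarrow> col j = col k) \<Longrightarrow>
        \<kappa> * (\<Sum>n\<in>F. N n * (cmod (c n))\<^sup>2) \<le> energy a (exp_sum lam F c)"
    then show thesis by (rule that)
  qed
  \<comment> \<open>Negating the frequencies moves the remaining indices to the upper half-plane and
    changes no energy.\<close>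
  have lower_half: "Im (- lam n) \<ge> 0" if "n \<in> - U" for n using that by (simp add: U_def)
  have syn_reflected: "energy a (exp_sum (\<lambda>n. - lam n) F c)
      \<le> C * (\<Sum>n\<in>F. energy a (exponential (- lam n)) * (cmod (c n))\<^sup>2)"
    if "finite F" "F \<subseteq> - U" for F c
    unfolding energy_exp_sum_reflect energy_exponential_reflect using syn[OF that(1)] by (simp add: N_def)
  obtain m2 :: nat and col2 :: "nat \<Rightarrow> nat" and \<kappa>2 :: real where 2: "\<And>n. col2 n < m2" "\<kappa>2 > 0"
    "\<And>F c. finite F \<Longrightarrow> F \<subseteq> - U \<Longrightarrow> (\<And>j k. j \<in> F \<Longrightarrow> k \<in> F \<Longrightarrow> col2 j = col2 k) \<Longrightarrow>
      \<kappa>2 * (\<Sum>n\<in>F. N n * (cmod (c n))\<^sup>2) \<le> energy a (exp_sum lam F c)"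
  proof (rule upper_half_plane_lower_bounds[where I = "- U", OF assms(1) C lower_half syn_reflected,
        unfolded energy_exp_sum_reflect energy_exponential_reflect, folded N_def])
    fix m :: nat and col :: "nat \<Rightarrow> nat" and \<kappa> :: real
    assume "\<And>n. col n < m" "\<kappa> > 0"
      "\<And>F c. finite F \<Longrightarrow> F \<subseteq> - U \<Longrightarrow> (\<And>j k. j \<in> F \<Longrightarrow> k \<in> F \<Longrightarrow> col j = col k) \<Longrightarrow>
        \<kappa> * (\<Sum>n\<in>F. N n * (cmod (c n))\<^sup>2) \<le> energy a (exp_sum lam F c)"
    then show thesis by (rule that)
  qed
  define \<kappa> where "\<kappa> = min \<kappa>1 \<kappa>2"
  have \<kappa>: "\<kappa> > 0" using 1 2 by (simp add: \<kappa>_def)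
  \<comment> \<open>Recording the half-plane along with the colour keeps each class inside
    \<open>U\<close> or inside its complement.\<close>
  define cell :: "nat \<Rightarrow> bool \<times> nat" where
    "cell n = (n \<in> U, if n \<in> U then col1 n else col2 n)" for n
  \<comment> \<open>Only fibres over attained values are taken, because a partition has no empty
    member.\<close>
  define P where "P = (\<lambda>v. cell -` {v}) ` range cell"
  have lower: "\<kappa> * (\<Sum>n\<in>F. N n * (cmod (c n))\<^sup>2) \<le> energy a (exp_sum lam F c)"
    if F: "finite F" and same: "\<And>j k. j \<in> F \<Longrightarrow> k \<in> F \<Longrightarrow> cell j = cell k" for F c
  proof -
    define X where "X = (\<Sum>n\<in>F. N n * (cmod (c n))\<^sup>2)"
    have X: "X \<ge> 0" using N by (auto simp: X_def less_imp_le intro!: sum_nonneg)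
    have cases: "F \<subseteq> U \<or> F \<subseteq> - U"
    proof (rule ccontr)
      assume "\<not> (F \<subseteq> U \<or> F \<subseteq> - U)"
      then obtain j k where "j \<in> F" "j \<notin> U" "k \<in> F" "k \<in> U" by blast
      then show False using same[of j k] by (simp add: cell_def)
    qed
    then show ?thesis
    proof
      assume FU: "F \<subseteq> U"
      have col: "col1 j = col1 k" if "j \<in> F" "k \<in> F" for j k
      proof -
        have "j \<in> U" "k \<in> U" using FU that by auto
        then show ?thesis using same[OF that] by (simp add: cell_def)
      qed
      have "\<kappa>1 * X \<le> energy a (exp_sum lam F c)"
        unfolding X_def by (rule 1(3)[OF F FU col])
      moreover have "\<kappa> * X \<le> \<kappa>1 * X" using X by (intro mult_right_mono) (auto simp: \<kappa>_def)
      ultimately show ?thesis by (simp add: X_def)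
    next
      assume FU: "F \<subseteq> - U"
      have col: "col2 j = col2 k" if "j \<in> F" "k \<in> F" for j k
      proof -
        have "j \<notin> U" "k \<notin> U" using FU that by auto
        then show ?thesis using same[OF that] by (simp add: cell_def)
      qed
      have "\<kappa>2 * X \<le> energy a (exp_sum lam F c)"
        unfolding X_def by (rule 2(3)[OF F FU col])
      moreover have "\<kappa> * X \<le> \<kappa>2 * X" using X by (intro mult_right_mono) (auto simp: \<kappa>_def)
      ultimately show ?thesis by (simp add: X_def)
    qed
  qed
  have "partition_on UNIV P"
    by (auto simp: partition_on_def disjoint_def P_def)
  moreover have "finite P"
  proof -
    have "range cell \<subseteq> UNIV \<times> {..<max m1 m2}"
      using 1(1) 2(1) by (auto simp: cell_def less_max_iff_disj)
    then have "finite (range cell)" by (rule finite_subset) simp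
    then show ?thesis unfolding P_def by (rule finite_imageI)
  qed
  moreover have "Riesz_basic_on M I h" if I: "I \<in> P" for I
    unfolding Riesz_basic_on_def
  \<comment> \<open>One constant for both sides: it is at least \<open>C\<close>, and its inverse is
    at most \<open>\<kappa>\<close>.\<close>
  proof (intro conjI exI[of _ "max C (1 / \<kappa>)"] allI impI ballI L2)
    show "max C (1 / \<kappa>) > 0" using C by (simp add: less_max_iff_disj)
    fix F :: "nat set" and c :: "nat \<Rightarrow> complex"
    assume F: "finite F \<and> F \<subseteq> I"
    define S where "S = (\<Sum>n\<in>F. (cmod (c n))\<^sup>2)"
    have S: "S \<ge> 0" by (simp add: S_def sum_nonneg)
    have same: "cell j = cell k" if "j \<in> F" "k \<in> F" for j k
    proof -
      obtain v where "I = cell -` {v}" using I unfolding P_def by (rule imageE)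
      then have "cell j = v" "cell k = v" using F that by auto
      then show ?thesis by simp
    qed
    have S_eq: "(\<Sum>n\<in>F. N n * (cmod (c n / of_real (sqrt (N n))))\<^sup>2) = S"
      unfolding S_def
    proof (intro sum.cong refl)
      fix n
      show "N n * (cmod (c n / of_real (sqrt (N n))))\<^sup>2 = (cmod (c n))\<^sup>2"
        using N[of n] by (simp add: norm_divide power_divide)
    qed
    have "inverse (max C (1 / \<kappa>)) \<le> inverse (1 / \<kappa>)"
      using \<kappa> by (intro le_imp_inverse_le) auto
    then have "inverse (max C (1 / \<kappa>)) * S \<le> \<kappa> * S"
      using S by (intro mult_right_mono) auto
    also have "\<dots> \<le> (L2_norm M (\<lambda>t. \<Sum>n\<in>F. c n * h n t))\<^sup>2"
      unfolding norm_h S_eq[symmetric] by (rule lower[OF conjunct1[OF F] same])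
    finally show "inverse (max C (1 / \<kappa>)) * (\<Sum>n\<in>F. (cmod (c n))\<^sup>2) \<le> (L2_norm M (\<lambda>t. \<Sum>n\<in>F. c n * h n t))\<^sup>2"
      unfolding S_def .
    have "(L2_norm M (\<lambda>t. \<Sum>n\<in>F. c n * h n t))\<^sup>2 \<le> C * S"
      unfolding S_def using F by (intro synthesis) auto
    also have "\<dots> \<le> max C (1 / \<kappa>) * S" using S by (intro mult_right_mono) auto
    finally show "(L2_norm M (\<lambda>t. \<Sum>n\<in>F. c n * h n t))\<^sup>2 \<le> max C (1 / \<kappa>) * (\<Sum>n\<in>F. (cmod (c n))\<^sup>2)"
      by (simp add: S_def)
  qed
  ultimately show ?thesis
    unfolding splits_into_finitely_many_Riesz_basic_def M_def h_def[abs_def] by blast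
qed

end
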